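(* Let $V=C^\infty(\mathcal B)$, $V^\star=C^\infty(\mathcal B)\times C^\infty(\partial\mathcal B)$ and $T^\star V=V\times V^\star$, and let $\Omega_{T^\star V}$ be the canonical symplectic form on $T^\star V$. The subbundle $D_{T^\star V}=\operatorname{graph}\Omega_{T^\star V}^\flat$ of the restricted Pontryagin bundle $T(T^\star V)\oplus T^\star(T^\star V)$ is a Dirac structure on $T^\star V$, i.e. $D_{T^\star V}^\perp=D_{T^\star V}$.
   Context: $\mathcal B\subset\mathbb R^m$ is a bounded domain with smooth boundary, regarded as compact (boundary included); $C^\infty(\mathcal B)$ is the Fréchet space of functions smooth up to the boundary. The restricted dual $V^\star=C^\infty(\mathcal B)\times C^\infty(\partial\mathcal B)$ is paired with $V$ by $\langle(\alpha,\alpha_\partial),\varphi\rangle=\int_{\mathcal B}\alpha\varphi\,dx+\int_{\partial\mathcal B}\alpha_\partial\varphi\,ds$. Restricted bundles: $T(T^\star V)=V\times V^\star\times V\times V^\star$ and $T^\star(T^\star V)=V\times V^\star\times V^\star\times V$, both over $T^\star V=V\times V^\star$ (first two factors). A covector $(\beta,\beta_\partial,\psi)\in V^\star\times V=T^\star_z(T^\star V)$ acts on a vector $(\delta\varphi,\delta\alpha,\delta\alpha_\partial)\in V\times V^\star=T_z(T^\star V)$ by $\langle(\beta,\beta_\partial),\delta\varphi\rangle+\langle(\delta\alpha,\delta\alpha_\partial),\psi\rangle$. The canonical one-form is $\Theta_{T^\star V}(\varphi,\alpha,\alpha_\partial)\cdot(\delta\varphi,\delta\alpha,\delta\alpha_\partial)=\langle(\alpha,\alpha_\partial),\delta\varphi\rangle$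 and $\Omega_{T^\star V}=-\mathrm d\Theta_{T^\star V}$, i.e. $\Omega_{T^\star V}(\varphi,\alpha,\alpha_\partial)((\dot\varphi,\dot\alpha,\dot\alpha_\partial),(\delta\varphi,\delta\alpha,\delta\alpha_\partial))=\langle(\delta\alpha,\delta\alpha_\partial),\dot\varphi\rangle-\langle(\dot\alpha,\dot\alpha_\partial),\delta\varphi\rangle$. The flat map $\Omega^\flat_{T^\star V}:T(T^\star V)\to T^\star(T^\star V)$ is $\Omega_{T^\star V}^\flat(z)(u)=\Omega_{T^\star V}(z)(u,\cdot)$. On each fiber $T_z(T^\star V)\oplus T_z^\star(T^\star V)$ define $\langle\!\langle(u_1,a_1),(u_2,a_2)\rangle\!\rangle=a_1(u_2)+a_2(u_1)$. For a subbundle $D$, $D^\perp(z)$ is the set of $(u_1,a_1)\in T_z(T^\star V)\times T_z^\star(T^\star V)$ with $\langle\!\langle(u_1,a_1),(u_2,a_2)\rangle\!\rangle=0$ for all $(u_2,a_2)\in D(z)$. A Dirac structure on $T^\star V$ is a subbundle $D$ of the restricted Pontryagin bundle with $D^\perp=D$ (no integrability condition required). *)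

theory Defs
  imports "HOL-Analysis.Analysis" "HOL-Library.Function_Algebras"
begin

text \<open>Real-valued functions form a real vector space under the pointwise operations; products of
  function spaces then inherit the library's vector space structure on pairs.\<close>

instantiation "fun" :: (type, scaleR) scaleR
begin

definition scaleR_fun :: "real \<Rightarrow> ('a \<Rightarrow> 'b) \<Rightarrow> 'a \<Rightarrow> 'b" where
  "scaleR_fun c f = (\<lambda>x. c *\<^sub>R f x)"

instance ..

end

instance "fun" :: (type, real_vector) real_vector
  by standard (simp_all add: scaleR_fun_def fun_eq_iff scaleR_add_right scaleR_add_left)


section \<open>Smooth functions and smooth domains\<close>

primrec iter_partial ::
  "'a::euclidean_space list \<Rightarrow> ('a \<Rightarrow> 'b::real_normed_vector) \<Rightarrow> 'a \<Rightarrow> 'b" where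
  "iter_partial [] f = f"
| "iter_partial (b # bs) f = (\<lambda>x. frechet_derivative (iter_partial bs f) (at x) b)"

definition smooth_on :: "'a::euclidean_space set \<Rightarrow> ('a \<Rightarrow> 'b::real_normed_vector) \<Rightarrow> bool" where
  "smooth_on U f \<longleftrightarrow> open U \<and> (\<forall>bs\<in>lists Basis. \<forall>x\<in>U. iter_partial bs f differentiable (at x))"

text \<open>For an arbitrary set \<open>S\<close>, a function is smooth if near every point of \<open>S\<close> it is the restriction
  of a smooth function of the ambient space. For a smooth compact domain this is smoothness up to
  the boundary, for the boundary hypersurface it is smoothness on a submanifold. A function on \<open>S\<close>
  is represented by its extension by zero, so that equality of representatives is equality on \<open>S\<close>.\<close>

definition Cinf :: "'a::euclidean_space set \<Rightarrow> ('a \<Rightarrow> real) set" where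
  "Cinf S = {f. (\<forall>x. x \<notin> S \<longrightarrow> f x = 0) \<and>
                (\<forall>p\<in>S. \<exists>U g. p \<in> U \<and> smooth_on U g \<and> (\<forall>x\<in>U \<inter> S. f x = g x))}"

text \<open>\<open>B\<close> is the closure of a bounded domain (its interior) whose boundary is locally, in suitable
  orthonormal coordinates with last axis \<open>n\<close>, the graph of a smooth function \<open>h\<close> of the remaining
  coordinates, with \<open>B\<close> lying on one side of it.\<close>

definition smooth_bounded_domain :: "'a::euclidean_space set \<Rightarrow> bool" where
  "smooth_bounded_domain B \<longleftrightarrow>
     compact B \<and> interior B \<noteq> {} \<and> connected (interior B) \<and>
     (\<forall>p\<in>frontier B. \<exists>n r h. norm n = 1 \<and> r > 0 \<and> smooth_on UNIV (h :: 'a \<Rightarrow> real) \<and>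
        B \<inter> ball p r = {x \<in> ball p r. x \<bullet> n \<le> h (x - (x \<bullet> n) *\<^sub>R n)})"


section \<open>Surface measure\<close>

text \<open>The surface element \<open>ds\<close> of a smooth hypersurface of an \<open>m\<close>-dimensional space is the
  \<open>(m - 1)\<close>-dimensional Hausdorff measure, normalised so as to agree with Lebesgue measure in
  dimension \<open>k\<close>. Empty covering sets contribute nothing; this matters for \<open>k = 0\<close> because
  \<open>0 ^ 0 = 1\<close>, which is the correct weight of a singleton.\<close>

definition hausdorff_delta :: "nat \<Rightarrow> real \<Rightarrow> 'a::euclidean_space set \<Rightarrow> ennreal" where
  "hausdorff_delta k \<delta> A =
     (INF E \<in> {E :: nat \<Rightarrow> 'a set. A \<subseteq> (\<Union>i. E i) \<and> (\<forall>i. bounded (E i) \<and> diameter (E i) \<le> \<delta>)}.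
        \<Sum>i. if E i = {} then 0
             else ennreal (unit_ball_vol (real k) * (diameter (E i) / 2) ^ k))"

definition hausdorff_measure :: "nat \<Rightarrow> 'a::euclidean_space measure" where
  "hausdorff_measure k = measure_of UNIV (sets borel) (\<lambda>A. SUP \<delta>\<in>{0<..}. hausdorff_delta k \<delta> A)"

definition surface_integral :: "'a::euclidean_space set \<Rightarrow> ('a \<Rightarrow> real) \<Rightarrow> real" where
  "surface_integral B f = (LINT x : frontier B | hausdorff_measure (DIM('a) - 1). f x)"


section \<open>Phase space and its restricted bundles\<close>

text \<open>\<open>'a dual\<close> is the type of pairs \<open>(\<alpha>, \<alpha>\<^sub>\<partial>)\<close>, \<open>'a phase\<close> that of triples \<open>(\<phi>, \<alpha>, \<alpha>\<^sub>\<partial>)\<close> (points of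
  the phase space and tangent vectors), and \<open>'a covec\<close> that of covectors \<open>((\<beta>, \<beta>\<^sub>\<partial>), \<psi>)\<close>.\<close>

type_synonym 'a dual = "('a \<Rightarrow> real) \<times> ('a \<Rightarrow> real)"
type_synonym 'a phase = "('a \<Rightarrow> real) \<times> 'a dual"
type_synonym 'a covec = "'a dual \<times> ('a \<Rightarrow> real)"

definition V :: "'a::euclidean_space set \<Rightarrow> ('a \<Rightarrow> real) set" where
  "V B = Cinf B"

definition Vstar :: "'a::euclidean_space set \<Rightarrow> 'a dual set" where
  "Vstar B = Cinf B \<times> Cinf (frontier B)"

definition TstarV :: "'a::euclidean_space set \<Rightarrow> 'a phase set" where
  "TstarV B = V B \<times> Vstar B"

text \<open>The bundles over \<open>TstarV B\<close> are trivial: \<open>tangent_fiber\<close> and \<open>cotangent_fiber\<close> are the fibers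
  of the restricted tangent and cotangent bundles at every base point.\<close>

definition tangent_fiber :: "'a::euclidean_space set \<Rightarrow> 'a phase set" where
  "tangent_fiber B = V B \<times> Vstar B"

definition cotangent_fiber :: "'a::euclidean_space set \<Rightarrow> 'a covec set" where
  "cotangent_fiber B = Vstar B \<times> V B"

definition Pontryagin_bundle ::
  "'a::euclidean_space set \<Rightarrow> ('a phase \<times> 'a phase \<times> 'a covec) set" where
  "Pontryagin_bundle B = TstarV B \<times> (tangent_fiber B \<times> cotangent_fiber B)"

definition pairing :: "'a::euclidean_space set \<Rightarrow> 'a dual \<Rightarrow> ('a \<Rightarrow> real) \<Rightarrow> real" where
  "pairing B = (\<lambda>(\<alpha>, \<alpha>d) \<phi>. (LINT x : B | lborel. \<alpha> x * \<phi> x) + surface_integral B (\<lambda>x. \<alpha>d x * \<phi> x))"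

definition covec_act :: "'a::euclidean_space set \<Rightarrow> 'a covec \<Rightarrow> 'a phase \<Rightarrow> real" where
  "covec_act B = (\<lambda>(\<beta>, \<psi>) (\<delta>\<phi>, \<delta>\<alpha>). pairing B \<beta> \<delta>\<phi> + pairing B \<delta>\<alpha> \<psi>)"


section \<open>Canonical forms\<close>

definition canonical_one_form :: "'a::euclidean_space set \<Rightarrow> 'a phase \<Rightarrow> 'a phase \<Rightarrow> real" where
  "canonical_one_form B = (\<lambda>(\<phi>, \<alpha>) (\<delta>\<phi>, \<delta>\<alpha>). pairing B \<alpha> \<delta>\<phi>)"

text \<open>Exterior derivative of a one-form on a vector space, evaluated on two vectors extended as
  constant vector fields, so that the Lie bracket term vanishes.\<close>

definition ext_derivative ::
  "('v::real_vector \<Rightarrow> 'v \<Rightarrow> real) \<Rightarrow> 'v \<Rightarrow> 'v \<Rightarrow> 'v \<Rightarrow> real" where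
  "ext_derivative \<Theta> z u w =
     deriv (\<lambda>t. \<Theta> (z + t *\<^sub>R u) w) 0 - deriv (\<lambda>t. \<Theta> (z + t *\<^sub>R w) u) 0"

definition canonical_two_form ::
  "'a::euclidean_space set \<Rightarrow> 'a phase \<Rightarrow> 'a phase \<Rightarrow> 'a phase \<Rightarrow> real" where
  "canonical_two_form B z u w = - ext_derivative (canonical_one_form B) z u w"

text \<open>The flat map sends \<open>u\<close> to the element of the restricted cotangent space that acts on tangent
  vectors as \<open>\<Omega> z u\<close>. It is determined by this action because the pairing is nondegenerate.\<close>

definition Omega_flat :: "'a::euclidean_space set \<Rightarrow> 'a phase \<Rightarrow> 'a phase \<Rightarrow> 'a covec" where
  "Omega_flat B z u = (THE a. a \<in> cotangent_fiber B \<and>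
     (\<forall>w\<in>tangent_fiber B. covec_act B a w = canonical_two_form B z u w))"

definition graph_Omega_flat ::
  "'a::euclidean_space set \<Rightarrow> ('a phase \<times> 'a phase \<times> 'a covec) set" where
  "graph_Omega_flat B = {(z, u, Omega_flat B z u) | z u. z \<in> TstarV B \<and> u \<in> tangent_fiber B}"


section \<open>Frechet topologies and subbundles\<close>

definition seminorm_topology ::
  "'v::real_vector set \<Rightarrow> ('v \<Rightarrow> real) set \<Rightarrow> 'v topology" where
  "seminorm_topology X P =
     topology_generated_by {{g \<in> X. p (g - f) < e} | p f e. p \<in> P \<and> f \<in> X \<and> e > 0}"

text \<open>On the compact domain: uniform convergence of all partial derivatives. Derivatives are taken
  in the interior, where they do not depend on the extension by zero.\<close>

definition Cinf_topology :: "'a::euclidean_space set \<Rightarrow> ('a \<Rightarrow> real) topology" where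
  "Cinf_topology B = seminorm_topology (Cinf B)
     {(\<lambda>f. SUP x\<in>interior B. \<bar>iter_partial bs f x\<bar>) | bs. bs \<in> lists Basis}"

text \<open>On the boundary: uniform convergence on compacta of all partial derivatives of the pullbacks
  along smooth maps \<open>\<gamma>\<close> from open sets \<open>W\<close> of the ambient space into the boundary. It suffices to take
  local parametrisations precomposed with a projection to \<open>m - 1\<close> coordinates, so this is the usual
  topology of uniform convergence of all derivatives in charts.\<close>

definition Cinf_boundary_topology :: "'a::euclidean_space set \<Rightarrow> ('a \<Rightarrow> real) topology" where
  "Cinf_boundary_topology B = seminorm_topology (Cinf (frontier B))
     {(\<lambda>f. SUP x\<in>K. \<bar>iter_partial bs (f \<circ> \<gamma>) x\<bar>) | bs (\<gamma> :: 'a \<Rightarrow> 'a) W K.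
        bs \<in> lists Basis \<and> smooth_on W \<gamma> \<and> \<gamma> ` W \<subseteq> frontier B \<and>
        compact K \<and> K \<noteq> {} \<and> K \<subseteq> W}"

definition Vstar_topology :: "'a::euclidean_space set \<Rightarrow> 'a dual topology" where
  "Vstar_topology B = prod_topology (Cinf_topology B) (Cinf_boundary_topology B)"

definition phase_topology :: "'a::euclidean_space set \<Rightarrow> 'a phase topology" where
  "phase_topology B = prod_topology (Cinf_topology B) (Vstar_topology B)"

definition covec_topology :: "'a::euclidean_space set \<Rightarrow> 'a covec topology" where
  "covec_topology B = prod_topology (Vstar_topology B) (Cinf_topology B)"

text \<open>Smoothness (in the sense of Michal, Bastiani and Hamilton) of a map on an open subset \<open>U\<close> of \<open>X\<close>:
  the iterated directional derivatives \<open>D k h x\<close> at \<open>x\<close> in the directions \<open>h 0, \<dots>, h (k - 1)\<close> exist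
  and are jointly continuous. The remaining entries of the sequence \<open>h\<close> play no role.\<close>

definition frechet_smooth ::
  "'v::real_vector topology \<Rightarrow> 'v set \<Rightarrow> 'w::real_vector topology \<Rightarrow> ('v \<Rightarrow> 'w) \<Rightarrow> bool" where
  "frechet_smooth X U Y f \<longleftrightarrow>
     (\<exists>D :: nat \<Rightarrow> (nat \<Rightarrow> 'v) \<Rightarrow> 'v \<Rightarrow> 'w.
        (\<forall>h. \<forall>x\<in>U. D 0 h x = f x) \<and>
        (\<forall>k h. \<forall>x\<in>U. range h \<subseteq> topspace X \<longrightarrow>
           limitin Y (\<lambda>t::real. (1 / t) *\<^sub>R (D k h (x + t *\<^sub>R h k) - D k h x)) (D (Suc k) h x) (at 0)) \<and>
        (\<forall>k. continuous_map (prod_topology (product_topology (\<lambda>_. X) UNIV) (subtopology X U)) Y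
               (\<lambda>(h, x). D k h x)))"

text \<open>Subbundles of the trivial vector bundle with base \<open>M\<close> and fiber \<open>E\<close>: locally there is a smooth
  vector bundle automorphism \<open>\<Phi>\<close>, with inverse \<open>\<Psi>\<close>, that maps the fibers of \<open>D\<close> onto one fixed closed
  complemented subspace, the range of a continuous linear projection \<open>P\<close> of the fiber.\<close>

definition vector_subbundle ::
  "'v::real_vector topology \<Rightarrow> 'w::real_vector topology \<Rightarrow> ('v \<times> 'w) set \<Rightarrow> bool" where
  "vector_subbundle M E D \<longleftrightarrow>
     D \<subseteq> topspace M \<times> topspace E \<and>
     (\<forall>z0\<in>topspace M. \<exists>U \<Phi> \<Psi> P. openin M U \<and> z0 \<in> U \<and>
        (\<forall>z\<in>U. linear (\<Phi> z) \<and> linear (\<Psi> z) \<and>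
           (\<forall>e\<in>topspace E. \<Phi> z e \<in> topspace E \<and> \<Psi> z e \<in> topspace E \<and>
              \<Psi> z (\<Phi> z e) = e \<and> \<Phi> z (\<Psi> z e) = e)) \<and>
        frechet_smooth (prod_topology M E) (U \<times> topspace E) E (\<lambda>(z, e). \<Phi> z e) \<and>
        frechet_smooth (prod_topology M E) (U \<times> topspace E) E (\<lambda>(z, e). \<Psi> z e) \<and>
        linear P \<and> continuous_map E E P \<and> (\<forall>e\<in>topspace E. P (P e) = P e) \<and>
        (\<forall>z\<in>U. \<forall>e\<in>topspace E. (z, e) \<in> D \<longleftrightarrow> \<Phi> z e \<in> P ` topspace E))"


section \<open>Dirac structures\<close>

definition Pontryagin_pairing ::
  "'a::euclidean_space set \<Rightarrow> 'a phase \<times> 'a covec \<Rightarrow> 'a phase \<times> 'a covec \<Rightarrow> real" where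
  "Pontryagin_pairing B = (\<lambda>(u1, a1) (u2, a2). covec_act B a1 u2 + covec_act B a2 u1)"

definition orthogonal_bundle ::
  "'a::euclidean_space set \<Rightarrow> ('a phase \<times> 'a phase \<times> 'a covec) set \<Rightarrow>
     ('a phase \<times> 'a phase \<times> 'a covec) set" where
  "orthogonal_bundle B D =
     {(z, v1) \<in> Pontryagin_bundle B. \<forall>v2. (z, v2) \<in> D \<longrightarrow> Pontryagin_pairing B v1 v2 = 0}"

definition Dirac_structure ::
  "'a::euclidean_space set \<Rightarrow> ('a phase \<times> 'a phase \<times> 'a covec) set \<Rightarrow> bool" where
  "Dirac_structure B D \<longleftrightarrow>
     vector_subbundle (phase_topology B) (prod_topology (phase_topology B) (covec_topology B)) D \<and>
     orthogonal_bundle B D = D"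

end

theory Submission
  imports Defs
begin

text \<open>Evaluating the exterior derivative gives \<open>\<Omega> (u, w) = \<langle>\<delta>\<alpha>, \<phi>\<rangle> - \<langle>\<alpha>, \<delta>\<phi>\<rangle>\<close>, so the flat map sends \<open>(\<phi>, \<alpha>)\<close>
  to \<open>(- \<alpha>, \<phi>)\<close> provided the pairing is nondegenerate on both sides. Then \<open>D\<^sup>\<bottom> = D\<close> is immediate from
  skew-symmetry of \<open>\<Omega>\<close> and nondegeneracy, and the fiber of \<open>D\<close> is the range of the
  continuous projection \<open>(u, a) \<mapsto> (u, \<Omega>\<^sup>\<flat> u)\<close>, which does not depend on the base point.

  Nondegeneracy is tested against functions cut off by bumps. For the boundary term this needs that
  \<open>(m - 1)\<close>-dimensional Hausdorff measure is a Borel measure (Caratheodory's criterion) which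
  on \<open>\<partial>B\<close> is finite and positive on relatively open sets. Both bounds follow by comparing \<open>\<partial>B\<close>, locally a
  Lipschitz graph, with a flat cube of dimension \<open>m - 1\<close>.\<close>

section \<open>Calculus of smooth functions\<close>

text \<open>Two library defaults shape the boundary part: a Bochner integral of a non-integrable
  function is 0, and \<open>measure_of\<close> returns the zero measure when its set function is not
  countably additive. Under these defaults the pairing could lose additivity or ignore its boundary
  component. Hence each property of surface measure has its own task: the Borel property gives
  \<open>surface_integral\<close> its meaning, finiteness makes continuous integrands integrable and
  the pairing additive, and positivity on relatively open sets turns a vanishing integral of a
  continuous nonnegative function into a vanishing function. For the subbundle condition, constancy
  of the fibers reduces everything to one topological fact, continuity of negation, which holds
  because the seminorms are even.\<close>

text \<open>A recursive form of the condition in \<open>smooth_on\<close>, peeling off the innermost derivative first,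
  so that the product and chain rules can be proved by induction on the order.\<close>

primrec diff_upto ::
  "nat \<Rightarrow> 'a::euclidean_space set \<Rightarrow> ('a \<Rightarrow> 'b::real_normed_vector) \<Rightarrow> bool" where
  "diff_upto 0 U f \<longleftrightarrow> (\<forall>x\<in>U. f differentiable (at x))"
| "diff_upto (Suc n) U f \<longleftrightarrow> (\<forall>x\<in>U. f differentiable (at x)) \<and>
     (\<forall>b\<in>Basis. diff_upto n U (\<lambda>x. frechet_derivative f (at x) b))"

lemma iter_partial_append: "iter_partial (bs @ cs) f = iter_partial bs (iter_partial cs f)"
  by (induction bs) auto

lemma diff_upto_iff_iter_partial:
  "diff_upto n U f \<longleftrightarrow>
     (\<forall>bs\<in>lists Basis. length bs \<le> n \<longrightarrow> (\<forall>x\<in>U. iter_partial bs f differentiable (at x)))"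
proof (induction n arbitrary: f)
  case 0
  then show ?case by auto
next
  case (Suc n)
  have "(\<forall>bs\<in>lists Basis. length bs \<le> Suc n \<longrightarrow> (\<forall>x\<in>U. iter_partial bs f differentiable (at x)))
    \<longleftrightarrow> (\<forall>x\<in>U. f differentiable (at x)) \<and> (\<forall>b\<in>Basis. \<forall>bs\<in>lists Basis. length bs \<le> n \<longrightarrow>
        (\<forall>x\<in>U. iter_partial (bs @ [b]) f differentiable (at x)))" (is "?L \<longleftrightarrow> ?R1 \<and> ?R2")
  proof
    assume L: ?L
    have ?R1 using L[rule_format, of "[]"] by simp
    moreover have ?R2 using L by simp
    ultimately show "?R1 \<and> ?R2" ..
  next
    assume R: "?R1 \<and> ?R2"
    show ?L
    proof (intro ballI impI)
      fix bs :: "'a list" and x assume bs: "bs \<in> lists Basis" "length bs \<le> Suc n" "x \<in> U"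
      show "iter_partial bs f differentiable (at x)"
      \<comment> \<open>New derivatives enter \<open>iter_partial\<close> at the head of the list,
        so the innermost one, which \<open>diff_upto\<close> peels off, is the last entry.\<close>
      proof (cases bs rule: rev_cases)
        case Nil
        then show ?thesis using R bs by simp
      next
        case (snoc cs c)
        then show ?thesis using R bs by auto
      qed
    qed
  qed
  then show ?case by (simp add: Suc.IH iter_partial_append)
qed

lemma smooth_on_iff_diff_upto: "smooth_on U f \<longleftrightarrow> open U \<and> (\<forall>n. diff_upto n U f)"
  unfolding smooth_on_def diff_upto_iff_iter_partial by blast

lemma diff_upto_differentiable: "diff_upto n U f \<Longrightarrow> x \<in> U \<Longrightarrow> f differentiable (at x)"
  by (cases n) auto

lemma diff_upto_Suc_imp: "diff_upto (Suc n) U f \<Longrightarrow> diff_upto n U f"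
  by (auto simp: diff_upto_iff_iter_partial)

section \<open>Locality of derivatives on open sets\<close>

lemma differentiable_transform_open:
  assumes "open U" "x \<in> U" "\<And>y. y \<in> U \<Longrightarrow> f y = g y"
  shows "f differentiable (at x) \<longleftrightarrow> g differentiable (at x)"
  using assms unfolding differentiable_def
  by (metis has_derivative_transform_within_open)

lemma frechet_derivative_transform_open:
  assumes "open U" "x \<in> U" "\<And>y. y \<in> U \<Longrightarrow> f y = g y"
  shows "frechet_derivative f (at x) = frechet_derivative g (at x)"
proof -
  have "(f has_derivative f') (at x) \<longleftrightarrow> (g has_derivative f') (at x)" for f'
    using assms by (metis has_derivative_transform_within_open)
  then show ?thesis by (simp add: frechet_derivative_def)
qed

lemma iter_partial_transform_open:
  assumes "open U" "x \<in> U" "\<And>y. y \<in> U \<Longrightarrow> f y = g y"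
  shows "iter_partial bs f x = iter_partial bs g x"
  using assms(2)
proof (induction bs arbitrary: x)
  case Nil
  then show ?case using assms by simp
next
  case (Cons b bs)
  then show ?case
    using frechet_derivative_transform_open[OF assms(1) Cons.prems, of "iter_partial bs f" "iter_partial bs g"]
    by simp
qed

lemma diff_upto_cong:
  assumes "open U" "\<And>y. y \<in> U \<Longrightarrow> f y = g y"
  shows "diff_upto n U f \<longleftrightarrow> diff_upto n U g"
proof -
  have "iter_partial bs f differentiable (at x) \<longleftrightarrow> iter_partial bs g differentiable (at x)" if "x \<in> U" for bs x
    by (rule differentiable_transform_open[OF assms(1) that iter_partial_transform_open[OF assms(1)]])
      (use assms(2) in auto)
  then show ?thesis by (simp add: diff_upto_iff_iter_partial)
qed

text \<open>Uniqueness of the Frechet derivative lets an explicit formula \<open>f'\<close> replace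
  the chosen \<open>frechet_derivative\<close>; since \<open>U\<close> is open, equality on
  \<open>U\<close> carries over to all higher derivatives. Sums, products and compositions are
  differentiated through this rule.\<close>

lemma diff_upto_SucI:
  assumes "open U" "\<And>x. x \<in> U \<Longrightarrow> (f has_derivative f' x) (at x)"
    "\<And>b. b \<in> Basis \<Longrightarrow> diff_upto n U (\<lambda>x. f' x b)"
  shows "diff_upto (Suc n) U f"
proof -
  have "frechet_derivative f (at x) = f' x" if "x \<in> U" for x
    using frechet_derivative_at[OF assms(2)[OF that]] by simp
  then have "diff_upto n U (\<lambda>x. frechet_derivative f (at x) b)" if "b \<in> Basis" for b
    using assms(3)[OF that] diff_upto_cong[OF assms(1), of "\<lambda>x. frechet_derivative f (at x) b" "\<lambda>x. f' x b" n]
    by simp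
  then show ?thesis using assms(2) by (auto simp: differentiable_def)
qed

lemma diff_upto_has_derivative:
  "diff_upto n U f \<Longrightarrow> x \<in> U \<Longrightarrow> (f has_derivative frechet_derivative f (at x)) (at x)"
  using diff_upto_differentiable frechet_derivative_works by blast

lemma diff_upto_const: "open U \<Longrightarrow> diff_upto n U (\<lambda>x. c)"
proof (induction n arbitrary: c)
  case (Suc n)
  show ?case by (rule diff_upto_SucI[where f' = "\<lambda>_ _. 0"]) (use Suc in auto)
qed auto

lemma diff_upto_linear:
  assumes "bounded_linear L" "open U"
  shows "diff_upto n U L"
proof (cases n)
  case 0
  then show ?thesis using assms bounded_linear_imp_has_derivative by (auto simp: differentiable_def)
next
  case (Suc k)
  show ?thesis unfolding Suc
    by (rule diff_upto_SucI[where f' = "\<lambda>_. L"])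
       (use assms diff_upto_const bounded_linear_imp_has_derivative in auto)
qed

lemma diff_upto_bounded_linear:
  fixes f :: "'a::euclidean_space \<Rightarrow> 'b::real_normed_vector" and L :: "'b \<Rightarrow> 'c::real_normed_vector"
  assumes "bounded_linear L" "open U" "diff_upto n U f"
  shows "diff_upto n U (\<lambda>x. L (f x))"
  using assms(3)
proof (induction n arbitrary: f)
  case 0
  then show ?case
    using bounded_linear.has_derivative[OF assms(1)] by (fastforce simp: differentiable_def)
next
  case (Suc n)
  show ?case
  proof (rule diff_upto_SucI[OF assms(2)])
    show "((\<lambda>x. L (f x)) has_derivative (\<lambda>h. L (frechet_derivative f (at x) h))) (at x)" if "x \<in> U" for x
      by (rule bounded_linear.has_derivative[OF assms(1) diff_upto_has_derivative[OF Suc.prems that]])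
  next
    fix b :: 'a assume "b \<in> Basis"
    then show "diff_upto n U (\<lambda>x. L (frechet_derivative f (at x) b))"
      using Suc by auto
  qed
qed

lemma diff_upto_add:
  assumes "open U" "diff_upto n U f" "diff_upto n U g"
  shows "diff_upto n U (\<lambda>x. f x + g x)"
  using assms(2,3)
proof (induction n arbitrary: f g)
  case (Suc n)
  show ?case
  proof (rule diff_upto_SucI[OF assms(1)])
    show "((\<lambda>x. f x + g x) has_derivative
        (\<lambda>h. frechet_derivative f (at x) h + frechet_derivative g (at x) h)) (at x)" if "x \<in> U" for x
      using diff_upto_has_derivative[OF Suc.prems(1) that] diff_upto_has_derivative[OF Suc.prems(2) that]
      by (rule has_derivative_add)
  qed (use Suc in auto)
qed auto

lemma diff_upto_sum:
  assumes "open U" "\<And>i. i \<in> I \<Longrightarrow> diff_upto n U (f i)"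
  shows "diff_upto n U (\<lambda>x. \<Sum>i\<in>I. f i x)"
  using assms(2)
  by (induction I rule: infinite_finite_induct) (auto intro: diff_upto_const diff_upto_add assms(1))

lemma diff_upto_mult:
  fixes f g :: "'a::euclidean_space \<Rightarrow> real"
  assumes "open U" "diff_upto n U f" "diff_upto n U g"
  shows "diff_upto n U (\<lambda>x. f x * g x)"
  using assms(2,3)
proof (induction n arbitrary: f g)
  case (Suc n)
  show ?case
  proof (rule diff_upto_SucI[OF assms(1)])
    show "((\<lambda>x. f x * g x) has_derivative
        (\<lambda>h. f x * frechet_derivative g (at x) h + frechet_derivative f (at x) h * g x)) (at x)" if "x \<in> U" for x
      using diff_upto_has_derivative[OF Suc.prems(1) that] diff_upto_has_derivative[OF Suc.prems(2) that]
      by (rule has_derivative_mult)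
    show "diff_upto n U (\<lambda>x. f x * frechet_derivative g (at x) b + frechet_derivative f (at x) b * g x)"
      if "b \<in> Basis" for b
      using Suc that diff_upto_Suc_imp[of n U f] diff_upto_Suc_imp[of n U g]
      by (intro diff_upto_add assms(1) Suc.IH) auto
  qed
qed auto

text \<open>In coordinates the chain rule gives a finite sum of products of a partial derivative of
  \<open>f\<close> with a partial derivative of \<open>g\<close> composed with \<open>f\<close>. The
  latter factor is again a composition with the same \<open>f\<close>, hence the induction
  generalises over \<open>g\<close> only.\<close>

lemma diff_upto_compose:
  fixes f :: "'a::euclidean_space \<Rightarrow> 'b::euclidean_space" and g :: "'b \<Rightarrow> real"
  assumes "open U" "diff_upto n U f" "diff_upto n W g" "f ` U \<subseteq> W"
  shows "diff_upto n U (\<lambda>x. g (f x))"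
  using assms(2,3)
proof (induction n arbitrary: g)
  case 0
  then show ?case using assms(4) differentiable_chain_at[of f _ g] by (auto simp: o_def)
next
  case (Suc n)
  let ?D = frechet_derivative
  show ?case
  proof (rule diff_upto_SucI[OF assms(1)])
    show "((\<lambda>x. g (f x)) has_derivative
        (\<lambda>h. \<Sum>i\<in>Basis. (?D f (at x) h \<bullet> i) * ?D g (at (f x)) i)) (at x)" if "x \<in> U" for x
    proof -
      have g: "(g has_derivative ?D g (at (f x))) (at (f x))"
        using diff_upto_has_derivative[OF Suc.prems(2)] assms(4) that by blast
      have "((\<lambda>x. g (f x)) has_derivative (\<lambda>h. ?D g (at (f x)) (?D f (at x) h))) (at x)"
        using diff_chain_at[OF diff_upto_has_derivative[OF Suc.prems(1) that] g] by (simp add: o_def)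
      moreover have "(\<lambda>h. ?D g (at (f x)) (?D f (at x) h))
          = (\<lambda>h. \<Sum>i\<in>Basis. (?D f (at x) h \<bullet> i) * ?D g (at (f x)) i)"
      proof
        fix h
        define v where "v = ?D f (at x) h"
        interpret linear "?D g (at (f x))" using g has_derivative_linear by blast
        have "?D g (at (f x)) v = ?D g (at (f x)) (\<Sum>i\<in>Basis. (v \<bullet> i) *\<^sub>R i)"
          by (simp add: euclidean_representation)
        also have "\<dots> = (\<Sum>i\<in>Basis. (v \<bullet> i) * ?D g (at (f x)) i)"
          by (simp add: sum scaleR)
        finally show "?D g (at (f x)) (?D f (at x) h) = (\<Sum>i\<in>Basis. (?D f (at x) h \<bullet> i) * ?D g (at (f x)) i)"
          by (simp add: v_def)
      qed
      ultimately show ?thesis by simp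
    qed
    show "diff_upto n U (\<lambda>x. \<Sum>i\<in>Basis. (?D f (at x) b \<bullet> i) * ?D g (at (f x)) i)" if "b \<in> Basis" for b
      using Suc that diff_upto_Suc_imp[of n U f]
      by (intro diff_upto_sum diff_upto_mult assms(1) Suc.IH
            diff_upto_bounded_linear[OF bounded_linear_inner_left]) auto
  qed
qed

section \<open>Closure properties of smooth functions\<close>

lemma smooth_on_open: "smooth_on U f \<Longrightarrow> open U"
  by (simp add: smooth_on_def)

lemma smooth_on_subset: "smooth_on U f \<Longrightarrow> open W \<Longrightarrow> W \<subseteq> U \<Longrightarrow> smooth_on W f"
  by (auto simp: smooth_on_def)

lemma smooth_on_cong:
  assumes "open U" "\<And>y. y \<in> U \<Longrightarrow> f y = g y"
  shows "smooth_on U f \<longleftrightarrow> smooth_on U g"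
  using diff_upto_cong[OF assms] assms(1) by (simp add: smooth_on_iff_diff_upto)

lemma smooth_on_const: "open U \<Longrightarrow> smooth_on U (\<lambda>x. c)"
  by (simp add: smooth_on_iff_diff_upto diff_upto_const)

lemma smooth_on_linear: "bounded_linear L \<Longrightarrow> open U \<Longrightarrow> smooth_on U L"
  by (simp add: smooth_on_iff_diff_upto diff_upto_linear)

lemma smooth_on_add: "smooth_on U f \<Longrightarrow> smooth_on U g \<Longrightarrow> smooth_on U (\<lambda>x. f x + g x)"
  by (simp add: smooth_on_iff_diff_upto diff_upto_add)

lemma smooth_on_bounded_linear:
  "bounded_linear L \<Longrightarrow> smooth_on U f \<Longrightarrow> smooth_on U (\<lambda>x. L (f x))"
  by (simp add: smooth_on_iff_diff_upto diff_upto_bounded_linear)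

lemma smooth_on_mult:
  fixes f g :: "'a::euclidean_space \<Rightarrow> real"
  shows "smooth_on U f \<Longrightarrow> smooth_on U g \<Longrightarrow> smooth_on U (\<lambda>x. f x * g x)"
  by (simp add: smooth_on_iff_diff_upto diff_upto_mult)

lemma smooth_on_sum:
  "open U \<Longrightarrow> (\<And>i. i \<in> I \<Longrightarrow> smooth_on U (f i)) \<Longrightarrow> smooth_on U (\<lambda>x. \<Sum>i\<in>I. f i x)"
  by (simp add: smooth_on_iff_diff_upto diff_upto_sum)

lemma smooth_on_compose:
  fixes f :: "'a::euclidean_space \<Rightarrow> 'b::euclidean_space" and g :: "'b \<Rightarrow> real"
  assumes "smooth_on U f" "smooth_on W g" "f ` U \<subseteq> W"
  shows "smooth_on U (\<lambda>x. g (f x))"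
  using assms diff_upto_compose by (fastforce simp: smooth_on_iff_diff_upto)

lemma smooth_on_iter_partial:
  "smooth_on U f \<Longrightarrow> bs \<in> lists Basis \<Longrightarrow> smooth_on U (iter_partial bs f)"
  by (auto simp: smooth_on_def iter_partial_append[symmetric])

lemma smooth_on_differentiable: "smooth_on U f \<Longrightarrow> x \<in> U \<Longrightarrow> f differentiable (at x)"
  by (auto simp: smooth_on_iff_diff_upto intro: diff_upto_differentiable)

lemma smooth_on_continuous_on: "smooth_on U f \<Longrightarrow> continuous_on U f"
  by (meson continuous_at_imp_continuous_on differentiable_imp_continuous_within smooth_on_differentiable)

text \<open>\<open>frechet_derivative\<close> is a choice operator, so the sign is pulled out at
  points where the iterated derivatives exist, which smoothness guarantees. It serves to show that
  the seminorms of both topologies are even.\<close>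

lemma iter_partial_uminus:
  assumes "smooth_on U f" "bs \<in> lists Basis" "x \<in> U"
  shows "iter_partial bs (\<lambda>y. - f y) x = - iter_partial bs f x"
  using assms(2,3)
proof (induction bs arbitrary: x rule: list.induct)
  case (Cons b bs)
  have "iter_partial (b # bs) (\<lambda>y. - f y) x = frechet_derivative (\<lambda>y. - iter_partial bs f y) (at x) b"
    using frechet_derivative_transform_open[OF smooth_on_open[OF assms(1)] Cons.prems(2),
        of "iter_partial bs (\<lambda>y. - f y)" "\<lambda>y. - iter_partial bs f y"] Cons
    by simp
  also have "(iter_partial bs f has_derivative frechet_derivative (iter_partial bs f) (at x)) (at x)"
    using assms(1) Cons.prems by (auto simp: smooth_on_def frechet_derivative_works)
  then have "frechet_derivative (\<lambda>y. - iter_partial bs f y) (at x)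
      = (\<lambda>h. - frechet_derivative (iter_partial bs f) (at x) h)"
    by (intro frechet_derivative_at[symmetric] has_derivative_minus)
  finally show ?case by simp
qed auto

subsection \<open>Bump functions\<close>

text \<open>The flat function \<open>exp (- 1 / t)\<close> together with its quotients by powers of
  \<open>t\<close>: the derivative of member \<open>k\<close> is a linear combination of members
  \<open>k + 2\<close> and \<open>k + 1\<close>, so one induction on the order, with
  \<open>k\<close> arbitrary, proves smoothness of all of them.\<close>

definition exp_recip :: "nat \<Rightarrow> real \<Rightarrow> real" where
  "exp_recip k t = (if t > 0 then exp (- 1 / t) / t ^ k else 0)"

lemma exp_recip_tendsto_0: "(exp_recip k \<longlongrightarrow> 0) (at_right 0)"
proof -
  have "((\<lambda>t::real. exp (- 1 / t) / t ^ k) \<longlongrightarrow> 0) (at_right 0)"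
  proof -
    have "((\<lambda>s::real. s ^ k / exp s) \<longlongrightarrow> 0) at_top" by (rule tendsto_power_div_exp_0)
    then have "((\<lambda>t::real. inverse t ^ k / exp (inverse t)) \<longlongrightarrow> 0) (at_right 0)"
      by (rule filterlim_compose[OF _ filterlim_inverse_at_top_right])
    then show ?thesis by (simp add: field_simps exp_minus)
  qed
  moreover have "eventually (\<lambda>t. exp (- 1 / t) / t ^ k = exp_recip k t) (at_right 0)"
    unfolding eventually_at_right_field by (intro exI[of _ 1]) (auto simp: exp_recip_def)
  ultimately show ?thesis by (rule Lim_transform_eventually)
qed

lemma DERIV_exp_recip:
  "(exp_recip k has_field_derivative exp_recip (k + 2) t - real k * exp_recip (k + 1) t) (at t)"
proof -
  consider "t > 0" | "t < 0" | "t = 0" by linarith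
  then show ?thesis
  proof cases
    case 1
    have "((\<lambda>t. exp (- 1 / t) / t ^ k) has_field_derivative exp_recip (k + 2) t - real k * exp_recip (k + 1) t) (at t)"
      using 1 by (auto intro!: derivative_eq_intros simp: exp_recip_def field_simps power2_eq_square)
        (cases k; simp add: field_simps)
    then show ?thesis
      by (rule has_field_derivative_transform_within_open[where S = "{0<..}"]) (use 1 in \<open>auto simp: exp_recip_def\<close>)
  next
    case 2
    have "((\<lambda>t. 0) has_field_derivative exp_recip (k + 2) t - real k * exp_recip (k + 1) t) (at t)"
      using 2 by (auto simp: exp_recip_def)
    then show ?thesis
      by (rule has_field_derivative_transform_within_open[where S = "{..<0}"]) (use 2 in \<open>auto simp: exp_recip_def\<close>)
  next
    case 3
    \<comment> \<open>At the origin the difference quotient is 0 from the left and equals the next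
      member \<open>exp_recip (Suc k)\<close> from the right, which tends to 0.\<close>
    have "((\<lambda>h. (exp_recip k (0 + h) - exp_recip k 0) / h) \<longlongrightarrow> 0) (at 0)"
      unfolding filterlim_at_split
    proof
      have "eventually (\<lambda>t. 0 = (exp_recip k (0 + t) - exp_recip k 0) / t) (at_left (0::real))"
        unfolding eventually_at_left_field by (intro exI[of _ "-1"]) (auto simp: exp_recip_def)
      then show "((\<lambda>h. (exp_recip k (0 + h) - exp_recip k 0) / h) \<longlongrightarrow> 0) (at_left 0)"
        by (rule Lim_transform_eventually[OF tendsto_const])
      have "eventually (\<lambda>t. exp_recip (Suc k) t = (exp_recip k (0 + t) - exp_recip k 0) / t) (at_right (0::real))"
        unfolding eventually_at_right_field by (intro exI[of _ "1"]) (auto simp: exp_recip_def)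
      then show "((\<lambda>h. (exp_recip k (0 + h) - exp_recip k 0) / h) \<longlongrightarrow> 0) (at_right 0)"
        by (rule Lim_transform_eventually[OF exp_recip_tendsto_0])
    qed
    then show ?thesis using 3 by (simp add: DERIV_def exp_recip_def)
  qed
qed

lemma smooth_on_exp_recip: "smooth_on UNIV (exp_recip k)"
proof -
  have "diff_upto n UNIV (exp_recip k)" for n
  proof (induction n arbitrary: k)
    case 0
    then show ?case
      using DERIV_exp_recip by (auto simp: differentiable_def has_field_derivative_def)
  next
    case (Suc n)
    show ?case
    proof (rule diff_upto_SucI)
      show "(exp_recip k has_derivative (\<lambda>h. (exp_recip (k + 2) t - real k * exp_recip (k + 1) t) * h)) (at t)" for t
        using DERIV_exp_recip by (simp add: has_field_derivative_def)
      have "diff_upto n UNIV (\<lambda>t. exp_recip (k + 2) t + (- real k) * exp_recip (k + 1) t)"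
        by (intro diff_upto_add diff_upto_mult diff_upto_const Suc) auto
      then show "diff_upto n UNIV (\<lambda>t. (exp_recip (k + 2) t - real k * exp_recip (k + 1) t) * b)"
        if "b \<in> Basis" for b
        using that by simp
    qed auto
  qed
  then show ?thesis by (simp add: smooth_on_iff_diff_upto)
qed

text \<open>The squared distance is a polynomial in the coordinates, so smoothness holds at the
  centre too. There is no plateau of value 1: only the sign of the bump enters the integral
  arguments.\<close>

definition bump :: "'a::euclidean_space \<Rightarrow> real \<Rightarrow> 'a \<Rightarrow> real" where
  "bump c r x = exp_recip 0 (r\<^sup>2 - (dist c x)\<^sup>2)"

lemma bump_nonneg: "bump c r x \<ge> 0"
  by (simp add: bump_def exp_recip_def)

lemma bump_eq_0: "r \<ge> 0 \<Longrightarrow> x \<notin> ball c r \<Longrightarrow> bump c r x = 0"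
  by (auto simp: bump_def exp_recip_def not_less power_mono)

lemma bump_pos: "x \<in> ball c r \<Longrightarrow> bump c r x > 0"
  by (auto simp: bump_def exp_recip_def power_strict_mono)

lemma smooth_on_bump: "smooth_on UNIV (bump c r)"
proof -
  have *: "smooth_on UNIV (\<lambda>x. x \<bullet> i + (- (c \<bullet> i)))" for i
    by (intro smooth_on_add smooth_on_const smooth_on_linear bounded_linear_inner_left open_UNIV)
  have "smooth_on UNIV (\<lambda>x. r\<^sup>2 + (\<Sum>i\<in>Basis. (-1) * ((x \<bullet> i + (- (c \<bullet> i))) * (x \<bullet> i + (- (c \<bullet> i))))))"
    by (rule smooth_on_add smooth_on_sum smooth_on_mult smooth_on_const open_UNIV *)+
  moreover have "r\<^sup>2 + (\<Sum>i\<in>Basis. (-1) * ((x \<bullet> i + (- (c \<bullet> i))) * (x \<bullet> i + (- (c \<bullet> i))))) = r\<^sup>2 - (dist c x)\<^sup>2" for x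
  proof -
    have "(dist c x)\<^sup>2 = (x - c) \<bullet> (x - c)" by (metis dist_commute dist_norm power2_norm_eq_inner)
    also have "\<dots> = (\<Sum>i\<in>Basis. (x \<bullet> i + (- (c \<bullet> i))) * (x \<bullet> i + (- (c \<bullet> i))))"
      by (subst euclidean_inner) (simp add: inner_diff_left)
    finally show ?thesis by (simp add: sum_negf)
  qed
  ultimately have "smooth_on UNIV (\<lambda>x. r\<^sup>2 - (dist c x)\<^sup>2)" by simp
  then have "smooth_on UNIV (\<lambda>x. exp_recip 0 (r\<^sup>2 - (dist c x)\<^sup>2))"
    by (rule smooth_on_compose[OF _ smooth_on_exp_recip]) auto
  then show ?thesis unfolding bump_def .
qed

section \<open>Smooth functions on closed sets\<close>

lemma CinfI:
  assumes "\<And>x. x \<notin> S \<Longrightarrow> f x = 0"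
    "\<And>p. p \<in> S \<Longrightarrow> \<exists>U g. p \<in> U \<and> smooth_on U g \<and> (\<forall>x\<in>U \<inter> S. f x = g x)"
  shows "f \<in> Cinf S"
  using assms by (simp add: Cinf_def)

lemma Cinf_outside: "f \<in> Cinf S \<Longrightarrow> x \<notin> S \<Longrightarrow> f x = 0"
  by (simp add: Cinf_def)

lemma CinfE:
  assumes "f \<in> Cinf S" "p \<in> S"
  obtains U g where "p \<in> U" "smooth_on U g" "\<And>x. x \<in> U \<Longrightarrow> x \<in> S \<Longrightarrow> f x = g x"
  using assms unfolding Cinf_def by blast

lemma Cinf_0: "0 \<in> Cinf S"
  by (rule CinfI) (use smooth_on_const[OF open_UNIV] in \<open>force simp: zero_fun_def\<close>)+

lemma Cinf_add:
  assumes "f \<in> Cinf S" "g \<in> Cinf S"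
  shows "f + g \<in> Cinf S"
proof (rule CinfI)
  fix p assume p: "p \<in> S"
  obtain U f' where f: "p \<in> U" "smooth_on U f'" "\<And>x. x \<in> U \<Longrightarrow> x \<in> S \<Longrightarrow> f x = f' x"
    using CinfE[OF assms(1) p] by blast
  obtain W g' where g: "p \<in> W" "smooth_on W g'" "\<And>x. x \<in> W \<Longrightarrow> x \<in> S \<Longrightarrow> g x = g' x"
    using CinfE[OF assms(2) p] by blast
  have "smooth_on (U \<inter> W) (\<lambda>x. f' x + g' x)"
    using f(2) g(2) by (intro smooth_on_add) (auto intro: smooth_on_subset simp: smooth_on_open open_Int)
  then show "\<exists>U h. p \<in> U \<and> smooth_on U h \<and> (\<forall>x\<in>U \<inter> S. (f + g) x = h x)"
    using f g by (intro exI[of _ "U \<inter> W"] exI[of _ "\<lambda>x. f' x + g' x"]) auto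
qed (use assms in \<open>auto simp: Cinf_outside\<close>)

lemma Cinf_scaleR:
  assumes "f \<in> Cinf S"
  shows "c *\<^sub>R f \<in> Cinf S"
proof (rule CinfI)
  fix p assume p: "p \<in> S"
  obtain U g where g: "p \<in> U" "smooth_on U g" "\<And>x. x \<in> U \<Longrightarrow> x \<in> S \<Longrightarrow> f x = g x"
    using CinfE[OF assms(1) p] by blast
  then show "\<exists>U h. p \<in> U \<and> smooth_on U h \<and> (\<forall>x\<in>U \<inter> S. (c *\<^sub>R f) x = h x)"
    using smooth_on_bounded_linear[OF bounded_linear_scaleR_right g(2), of c]
    by (intro exI[of _ "U"] exI[of _ "\<lambda>x. c *\<^sub>R g x"]) (auto simp: scaleR_fun_def)
qed (use assms in \<open>auto simp: Cinf_outside scaleR_fun_def\<close>)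

lemma Cinf_uminus: "f \<in> Cinf S \<Longrightarrow> - f \<in> Cinf S"
  using Cinf_scaleR[of f S "-1"] by simp

lemma Cinf_diff: "f \<in> Cinf S \<Longrightarrow> g \<in> Cinf S \<Longrightarrow> f - g \<in> Cinf S"
  using Cinf_add[OF _ Cinf_uminus, of f S g] by simp

lemma Cinf_continuous_on:
  assumes "f \<in> Cinf S"
  shows "continuous_on S f"
  unfolding continuous_on_eq_continuous_within
proof
  fix p assume p: "p \<in> S"
  obtain U g where g: "p \<in> U" "smooth_on U g" "\<And>x. x \<in> U \<Longrightarrow> x \<in> S \<Longrightarrow> f x = g x"
    using CinfE[OF assms(1) p] by blast
  have "continuous (at p within S) g"
    using smooth_on_continuous_on[OF g(2)] smooth_on_open[OF g(2)] g(1)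
    by (simp add: continuous_on_eq_continuous_at continuous_at_imp_continuous_within)
  moreover obtain e where "e > 0" "ball p e \<subseteq> U"
    using smooth_on_open[OF g(2)] g(1) openE by blast
  ultimately show "continuous (at p within S) f"
    using g p by (intro continuous_transform_within[of p S g e f]) (auto simp: dist_commute subset_iff)
qed

text \<open>Near an interior point the local extension coincides with \<open>f\<close> on an open
  set. Hence derivatives taken in the interior are genuine, and an element of \<open>Cinf S\<close>
  can itself be cut off by a bump there.\<close>

lemma Cinf_smooth_on_interior:
  fixes f :: "'a::euclidean_space \<Rightarrow> real"
  assumes "f \<in> Cinf S"
  shows "smooth_on (interior S) f"
  unfolding smooth_on_def
proof (intro conjI ballI)
  fix bs :: "'a list" and x assume bs: "bs \<in> lists Basis" and x: "x \<in> interior S"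
  then obtain U g where g: "x \<in> U" "smooth_on U g" "\<And>y. y \<in> U \<Longrightarrow> y \<in> S \<Longrightarrow> f y = g y"
    using CinfE[OF assms] interior_subset by blast
  have o: "open (U \<inter> interior S)" using smooth_on_open[OF g(2)] by auto
  have eq: "f y = g y" if "y \<in> U \<inter> interior S" for y
    using that g(3) interior_subset by blast
  have "smooth_on (U \<inter> interior S) f"
    using smooth_on_cong[OF o, of f g] eq smooth_on_subset[OF g(2) o] by blast
  then show "iter_partial bs f differentiable (at x)"
    using bs x g(1) by (simp add: smooth_on_def)
qed auto

text \<open>\<open>f\<close> is extended by zero and may fail to be smooth off \<open>S\<close>; but
  \<open>\<gamma>\<close> takes values in \<open>S\<close>, so on the open preimage of
  \<open>U\<close> the composite agrees with \<open>g \<circ> \<gamma>\<close> for a smooth local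
  extension \<open>g\<close>. This makes the boundary seminorms accessible.\<close>

lemma Cinf_compose_smooth:
  fixes f :: "'a::euclidean_space \<Rightarrow> real" and \<gamma> :: "'b::euclidean_space \<Rightarrow> 'a"
  assumes "f \<in> Cinf S" "smooth_on W \<gamma>" "\<gamma> ` W \<subseteq> S"
  shows "smooth_on W (f \<circ> \<gamma>)"
  unfolding smooth_on_def
proof (intro conjI ballI)
  show "open W" using assms(2) by (rule smooth_on_open)
  fix bs :: "'b list" and x assume bs: "bs \<in> lists Basis" and x: "x \<in> W"
  then obtain U g where g: "\<gamma> x \<in> U" "smooth_on U g" "\<And>y. y \<in> U \<Longrightarrow> y \<in> S \<Longrightarrow> f y = g y"
    using CinfE[OF assms(1)] assms(3) by blast
  define N where "N = W \<inter> \<gamma> -` U"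
  have o: "open N" unfolding N_def
    using continuous_open_preimage[OF smooth_on_continuous_on[OF assms(2)] \<open>open W\<close> smooth_on_open[OF g(2)]] .
  have "smooth_on N (\<lambda>x. g (\<gamma> x))"
    by (rule smooth_on_compose[OF smooth_on_subset[OF assms(2) o] g(2)]) (auto simp: N_def)
  moreover have "(f \<circ> \<gamma>) y = g (\<gamma> y)" if "y \<in> N" for y
    using that g(3) assms(3) by (auto simp: N_def)
  ultimately have "smooth_on N (f \<circ> \<gamma>)"
    using smooth_on_cong[OF o, of "f \<circ> \<gamma>" "\<lambda>x. g (\<gamma> x)"] by blast
  then show "iter_partial bs (f \<circ> \<gamma>) differentiable (at x)"
    using bs x g(1) by (simp add: smooth_on_def N_def)
qed

text \<open>\<open>U\<close> and the complement of \<open>cball c r\<close> are open and cover the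
  space; the product is smooth on the first and zero on the second. So a merely local
  \<open>g\<close> yields a global element of \<open>Cinf S\<close>.\<close>

lemma Cinf_bump_mult:
  assumes "smooth_on U g" "cball c r \<subseteq> U" "r > 0"
  shows "(\<lambda>x. if x \<in> S then g x * bump c r x else 0) \<in> Cinf S"
proof (rule CinfI)
  fix p assume p: "p \<in> S"
  show "\<exists>U' h. p \<in> U' \<and> smooth_on U' h \<and> (\<forall>x\<in>U' \<inter> S. (if x \<in> S then g x * bump c r x else 0) = h x)"
  proof (cases "p \<in> U")
    case True
    have "smooth_on U (\<lambda>x. g x * bump c r x)"
      using assms(1) by (intro smooth_on_mult smooth_on_subset[OF smooth_on_bump]) (auto simp: smooth_on_open)
    then show ?thesis using True by (intro exI[of _ U] exI[of _ "\<lambda>x. g x * bump c r x"]) auto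
  next
    case False
    then show ?thesis using assms(2,3)
      by (intro exI[of _ "- cball c r"] exI[of _ "\<lambda>x. 0"]) (auto intro!: smooth_on_const bump_eq_0)
  qed
qed auto

section \<open>Metric outer measures\<close>

text \<open>\<open>d\<close> is 1-Lipschitz, so two shells whose indices differ by at least 2 are
  apart by at least the width of a shell between them. Keeping every second index (\<open>c\<close>
  selects the parity) makes \<open>metric\<close> applicable at each step.\<close>

lemma shells_additive:
  fixes f :: "'a::metric_space set \<Rightarrow> ennreal" and d :: "'a \<Rightarrow> real"
  assumes f0: "f {} = 0"
    and metric: "\<And>A B e. e > 0 \<Longrightarrow> (\<And>x y. x \<in> A \<Longrightarrow> y \<in> B \<Longrightarrow> e \<le> dist x y) \<Longrightarrow> f (A \<union> B) = f A + f B"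
    and d: "\<And>x y. \<bar>d x - d y\<bar> \<le> dist x y"
    and R: "\<And>n x. x \<in> R n \<Longrightarrow> 1 / real (n + 2) \<le> d x \<and> d x < 1 / real (n + 1)"
  shows "(\<Sum>i<n. f (R (2 * i + c))) = f (\<Union>i<n. R (2 * i + c))"
proof (induction n)
  case (Suc n)
  have "f ((\<Union>i<n. R (2 * i + c)) \<union> R (2 * n + c)) = f (\<Union>i<n. R (2 * i + c)) + f (R (2 * n + c))"
  \<comment> \<open>For \<open>n = 0\<close> the union is empty. Otherwise \<open>2 * n + c\<close>
    is positive, as the gap between the reciprocals requires: division by 0 gives 0.\<close>
  proof (cases n)
    case (Suc m)
    show ?thesis
    proof (rule metric)
      show "0 < 1 / real (2 * n + c) - 1 / real (2 * n + c + 1)"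
        using Suc divide_strict_left_mono[of "real (2 * n + c)" "real (2 * n + c + 1)" 1] by simp
      fix x y assume "x \<in> (\<Union>i<n. R (2 * i + c))" and y: "y \<in> R (2 * n + c)"
      then obtain i where i: "i < n" "x \<in> R (2 * i + c)" by blast
      have "1 / real (2 * n + c) \<le> 1 / real (2 * i + c + 2)"
        using i(1) by (intro divide_left_mono) auto
      then have "1 / real (2 * n + c) \<le> d x" using R[OF i(2)] by linarith
      moreover have "d y < 1 / real (2 * n + c + 1)" using R[OF y] by simp
      ultimately show "1 / real (2 * n + c) - 1 / real (2 * n + c + 1) \<le> dist x y"
        using d[of x y] by linarith
    qed
  qed (simp add: f0)
  then show ?case using Suc by (simp add: lessThan_Suc Un_commute)
qed (simp add: f0)

text \<open>Caratheodory's criterion. A test set minus a closed set is exhausted by the points at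
  distance at least \<open>1 / (n + 1)\<close>; the measures of the shells in between form a convergent series
  because shells of equal parity have positive distance from each other.\<close>

lemma closed_in_lambda_system:
  fixes f :: "'a::metric_space set \<Rightarrow> ennreal"
  assumes oms: "outer_measure_space (Pow UNIV) f"
    and metric: "\<And>A B e. e > 0 \<Longrightarrow> (\<And>x y. x \<in> A \<Longrightarrow> y \<in> B \<Longrightarrow> e \<le> dist x y) \<Longrightarrow> f (A \<union> B) = f A + f B"
    and "closed F"
  shows "F \<in> lambda_system UNIV (Pow UNIV) f"
proof -
  interpret sigma_algebra UNIV "Pow UNIV :: 'a set set" by (rule sigma_algebra_Pow)
  have f0: "f {} = 0" and mono: "\<And>A B. A \<subseteq> B \<Longrightarrow> f A \<le> f B" and cs: "countably_subadditive (Pow UNIV) f"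
    using oms by (auto simp: outer_measure_space_def positive_def increasing_def)
  have sub: "f (A \<union> B) \<le> f A + f B" for A B
  proof -
    have "f (A \<union> (B - A)) \<le> f A + f (B - A)"
      using countably_subadditive_subadditive[OF _ cs] f0
      by (intro subadditiveD[where M = "Pow UNIV"]) (auto simp: positive_def)
    also have "\<dots> \<le> f A + f B" by (intro add_left_mono mono) auto
    finally show ?thesis by simp
  qed
  have "f (F \<inter> A) + f (A - F) \<le> f A" for A
  \<comment> \<open>\<open>infdist\<close> to the empty set is 0 by convention, so
    \<open>F = {}\<close> is split off; finiteness of \<open>f A\<close> later permits cancelling
    the series of shells.\<close>
  proof (cases "F = {} \<or> f A = top")
    case True
    then show ?thesis using f0 by (auto simp: top_unique)
  next
    case False
    then have F: "F \<noteq> {}" and fin: "f A < top" by (auto simp: less_top)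
    define d where "d x = infdist x F" for x
    have d: "\<bar>d x - d y\<bar> \<le> dist x y" for x y
      unfolding d_def by (rule infdist_triangle_abs)
    have d_pos: "x \<notin> F \<longleftrightarrow> d x > 0" for x
      using in_closed_iff_infdist_zero[OF \<open>closed F\<close> F, of x] infdist_nonneg[of x F] by (auto simp: d_def)
    define K where "K n = {x \<in> A. 1 / real (n + 1) \<le> d x}" for n
    define R where "R n = {x \<in> A. 1 / real (n + 2) \<le> d x \<and> d x < 1 / real (n + 1)}" for n
    have 1: "f (F \<inter> A) + f (K n) \<le> f A" for n
    proof -
      have "f (F \<inter> A) + f (K n) = f ((F \<inter> A) \<union> K n)"
      proof (rule metric[symmetric])
        show "1 / real (n + 1) \<le> dist x y" if "x \<in> F \<inter> A" "y \<in> K n" for x y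
        proof -
          have "d x = 0" using that(1) by (simp add: d_def)
          then show ?thesis using that d[of x y] by (auto simp: K_def)
        qed
      qed auto
      also have "\<dots> \<le> f A" by (rule mono) (auto simp: K_def)
      finally show ?thesis .
    qed
    have parity: "(\<Sum>i<n. f (R (2 * i + c))) \<le> f A" for n c
    proof -
      have "(\<Sum>i<n. f (R (2 * i + c))) = f (\<Union>i<n. R (2 * i + c))"
        by (rule shells_additive[where d = d]) (use f0 metric d in \<open>auto simp: R_def\<close>)
      also have "\<dots> \<le> f A" by (rule mono) (auto simp: R_def)
      finally show ?thesis .
    qed
    define s where "s = (\<Sum>j. f (R j))"
    have "s \<le> f A + f A" unfolding s_def
    proof (rule suminf_le_const[OF summableI])
      fix n
      have "(\<Sum>j<n. f (R j)) \<le> (\<Sum>j<2 * n. f (R j))"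
        by (rule sum_mono2) auto
      also have "\<dots> = (\<Sum>i<n. f (R (2 * i + 0))) + (\<Sum>i<n. f (R (2 * i + 1)))"
        by (induction n) (auto simp: ac_simps)
      also have "\<dots> \<le> f A + f A" by (intro add_mono parity)
      finally show "(\<Sum>j<n. f (R j)) \<le> f A + f A" .
    qed
    then have s_fin: "s < top" using fin
      by (metis ennreal_add_less_top order_le_less_trans)
    have tail: "f (A - F) \<le> f (K n) + (\<Sum>j. f (R (j + n)))" for n
    proof -
      have "A - F \<subseteq> K n \<union> (\<Union>j. R (j + n))"
      proof
        fix x assume x: "x \<in> A - F"
        show "x \<in> K n \<union> (\<Union>j. R (j + n))"
        proof (cases "1 / real (n + 1) \<le> d x")
          case True
          then show ?thesis using x by (auto simp: K_def)
        next
          case False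
          have dx: "d x > 0" using x d_pos by blast
          \<comment> \<open>The first threshold reached by \<open>d x\<close>: failing at
            \<open>m - 1\<close> puts \<open>x\<close> into the shell with index
            \<open>m - 1\<close>, which belongs to the tail because \<open>n < m\<close>.\<close>
          define m where "m = (LEAST m. 1 / real (m + 1) \<le> d x)"
          obtain m0 where "1 / real (Suc m0) < d x" using nat_approx_posE[OF dx] by blast
          then have "\<exists>m. 1 / real (m + 1) \<le> d x" by (intro exI[of _ m0]) auto
          then have m: "1 / real (m + 1) \<le> d x" unfolding m_def by (rule LeastI_ex)
          have "n < m"
          proof (rule ccontr)
            assume "\<not> n < m"
            then have "1 / real (n + 1) \<le> 1 / real (m + 1)" by (intro divide_left_mono) auto
            then show False using m False by linarith
          qed
          then obtain j where j: "m = Suc (j + n)" using less_imp_Suc_add[of n m] by (auto simp: add.commute)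
          have "\<not> 1 / real ((j + n) + 1) \<le> d x"
            using not_less_Least[of "j + n" "\<lambda>m. 1 / real (m + 1) \<le> d x"] j by (simp add: m_def)
          then have "x \<in> R (j + n)" using m x by (auto simp: R_def j)
          then show ?thesis by blast
        qed
      qed
      then have "f (A - F) \<le> f (K n) + f (\<Union>j. R (j + n))"
        using mono sub order_trans by blast
      also have "f (\<Union>j. R (j + n)) \<le> (\<Sum>j. f (R (j + n)))"
      proof -
        have "R i \<inter> R j = {}" if "i < j" for i j
        proof -
          have "1 / real (j + 1) \<le> 1 / real (i + 2)" using that by (intro divide_left_mono) auto
          then show ?thesis by (force simp: R_def)
        qed
        then have "disjoint_family (\<lambda>j. R (j + n))"
          unfolding disjoint_family_on_def
          by (metis Int_commute add_less_cancel_right linorder_neqE_nat)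
        then show ?thesis using cs[unfolded countably_subadditive_def, rule_format, of "\<lambda>j. R (j + n)"] by simp
      qed
      finally show ?thesis by (simp add: add_left_mono)
    qed
    \<comment> \<open>Adding the first \<open>n\<close> shells completes the tail to the full series
      \<open>s\<close>. As \<open>n\<close> grows the left side gains \<open>s\<close> too, and
      being finite it cancels; this replaces a limit argument for the tails.\<close>
    have "f (F \<inter> A) + f (A - F) + (\<Sum>j<n. f (R j)) \<le> f A + s" for n
    proof -
      have "f (F \<inter> A) + f (A - F) + (\<Sum>j<n. f (R j))
          \<le> f (F \<inter> A) + (f (K n) + (\<Sum>j. f (R (j + n)))) + (\<Sum>j<n. f (R j))"
        by (intro add_mono tail order_refl)
      also have "\<dots> = (f (F \<inter> A) + f (K n)) + s"
        unfolding s_def suminf_offset[of "\<lambda>j. f (R j)" n, OF summableI] by (simp add: ac_simps)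
      also have "\<dots> \<le> f A + s" by (intro add_right_mono 1)
      finally show ?thesis .
    qed
    then have "(SUP n. f (F \<inter> A) + f (A - F) + (\<Sum>j<n. f (R j))) \<le> f A + s"
      by (intro SUP_least) auto
    then have "s + (f (F \<inter> A) + f (A - F)) \<le> s + f A"
      by (subst (asm) ennreal_SUP_add_right[symmetric]) (auto simp: s_def suminf_eq_SUP add.commute)
    then show ?thesis using s_fin by (auto simp: ennreal_add_left_cancel_le)
  qed
  moreover have "f A \<le> f (F \<inter> A) + f (A - F)" for A
    using sub[of "F \<inter> A" "A - F"] by (simp add: Int_commute Int_Diff_Un)
  ultimately have "f (F \<inter> A) + f (A - F) = f A" for A
    by (meson antisym)
  moreover have "(UNIV - F) \<inter> A = A - F" for A by blast
  ultimately show ?thesis by (simp add: lambda_system_def)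
qed

lemma metric_outer_measure_space_borel:
  fixes f :: "'a::metric_space set \<Rightarrow> ennreal"
  assumes oms: "outer_measure_space (Pow UNIV) f"
    and metric: "\<And>A B e. e > 0 \<Longrightarrow> (\<And>x y. x \<in> A \<Longrightarrow> y \<in> B \<Longrightarrow> e \<le> dist x y) \<Longrightarrow> f (A \<union> B) = f A + f B"
  shows "measure_space UNIV (sets borel) f"
proof -
  interpret sigma_algebra UNIV "Pow UNIV :: 'a set set" by (rule sigma_algebra_Pow)
  have ms: "measure_space UNIV (lambda_system UNIV (Pow UNIV) f) f"
    by (rule caratheodory_lemma[OF oms])
  then interpret L: sigma_algebra UNIV "lambda_system UNIV (Pow UNIV) f"
    by (simp add: measure_space_def)
  have "sets borel = sigma_sets UNIV (Collect closed :: 'a set set)"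
    by (simp add: borel_eq_closed)
  also have "\<dots> \<subseteq> lambda_system UNIV (Pow UNIV) f"
  proof (intro L.sigma_sets_subset subsetI)
    fix F :: "'a set" assume "F \<in> Collect closed"
    then show "F \<in> lambda_system UNIV (Pow UNIV) f"
      by (intro closed_in_lambda_system[OF oms metric]) auto
  qed
  finally show ?thesis
    using measure_down[OF ms] sets.sigma_algebra_axioms[of "borel :: 'a measure"] by simp
qed

section \<open>Hausdorff measure\<close>

definition hausdorff_weight :: "nat \<Rightarrow> 'a::euclidean_space set \<Rightarrow> ennreal" where
  "hausdorff_weight k E =
     (if E = {} then 0 else ennreal (unit_ball_vol (real k) * (diameter E / 2) ^ k))"

text \<open>Kept apart from \<open>hausdorff_measure\<close> as a function of arbitrary sets:
  monotonicity and the Lipschitz bound then apply to images without a measurability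
  argument.\<close>

definition hausdorff_outer :: "nat \<Rightarrow> 'a::euclidean_space set \<Rightarrow> ennreal" where
  "hausdorff_outer k A = (SUP \<delta>\<in>{0<..}. hausdorff_delta k \<delta> A)"

lemma hausdorff_weight_empty [simp]: "hausdorff_weight k {} = 0"
  by (simp add: hausdorff_weight_def)

lemma hausdorff_weight_le:
  fixes E :: "'a::euclidean_space set"
  assumes "bounded E" "diameter E \<le> r"
  shows "hausdorff_weight k E \<le> ennreal (unit_ball_vol (real k) * (r / 2) ^ k)"
  unfolding hausdorff_weight_def
  by (auto intro!: ennreal_leI mult_left_mono power_mono diameter_ge_0 assms divide_right_mono)

lemma hausdorff_delta_le:
  assumes "A \<subseteq> (\<Union>i. E i)" "\<And>i. bounded (E i)" "\<And>i. diameter (E i) \<le> \<delta>"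
  shows "hausdorff_delta k \<delta> A \<le> (\<Sum>i. hausdorff_weight k (E i))"
  unfolding hausdorff_delta_def hausdorff_weight_def by (rule INF_lower) (use assms in auto)

lemma hausdorff_delta_greatest:
  assumes "\<And>E. A \<subseteq> (\<Union>i. E i) \<Longrightarrow> (\<And>i. bounded (E i)) \<Longrightarrow> (\<And>i. diameter (E i) \<le> \<delta>)
    \<Longrightarrow> c \<le> (\<Sum>i. hausdorff_weight k (E i))"
  shows "c \<le> hausdorff_delta k \<delta> A"
  unfolding hausdorff_delta_def by (rule INF_greatest) (use assms in \<open>auto simp: hausdorff_weight_def\<close>)

lemma hausdorff_delta_approx:
  assumes "hausdorff_delta k \<delta> A < c"
  obtains E where "A \<subseteq> (\<Union>i. E i)" "\<And>i. bounded (E i)" "\<And>i. diameter (E i) \<le> \<delta>"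
    "(\<Sum>i. hausdorff_weight k (E i)) < c"
  using assms unfolding hausdorff_delta_def INF_less_iff hausdorff_weight_def by auto

lemma hausdorff_delta_mono: "A \<subseteq> B \<Longrightarrow> hausdorff_delta k \<delta> A \<le> hausdorff_delta k \<delta> B"
  by (rule hausdorff_delta_greatest) (auto intro!: hausdorff_delta_le)

lemma hausdorff_delta_antimono: "\<delta> \<le> \<epsilon> \<Longrightarrow> hausdorff_delta k \<epsilon> A \<le> hausdorff_delta k \<delta> A"
  by (rule hausdorff_delta_greatest) (auto intro!: hausdorff_delta_le intro: order_trans)

lemma hausdorff_delta_empty: "\<delta> \<ge> 0 \<Longrightarrow> hausdorff_delta k \<delta> {} = 0"
  using hausdorff_delta_le[of "{}" "\<lambda>_. {}" \<delta> k] by simp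

text \<open>The finite family is padded to a sequence by empty sets. These weigh 0 also for
  \<open>k = 0\<close>, and their diameter 0 is admissible because \<open>\<delta>\<close> is
  nonnegative.\<close>

lemma hausdorff_delta_finite_cover:
  assumes "finite I" "A \<subseteq> (\<Union>i\<in>I. E i)" "\<And>i. i \<in> I \<Longrightarrow> bounded (E i)"
    "\<And>i. i \<in> I \<Longrightarrow> diameter (E i) \<le> \<delta>" "\<delta> \<ge> 0"
  shows "hausdorff_delta k \<delta> A \<le> (\<Sum>i\<in>I. hausdorff_weight k (E i))"
proof -
  obtain e where e: "bij_betw e {..<card I} I"
    using ex_bij_betw_nat_finite[OF assms(1)] by (auto simp: atLeast0LessThan)
  define E' where "E' n = (if n < card I then E (e n) else {})" for n
  have eI: "n < card I \<Longrightarrow> e n \<in> I" for n using e by (auto simp: bij_betw_def)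
  have "hausdorff_delta k \<delta> A \<le> (\<Sum>n. hausdorff_weight k (E' n))"
  proof (rule hausdorff_delta_le)
    show "A \<subseteq> (\<Union>i. E' i)"
    proof
      fix x assume "x \<in> A"
      then obtain i where "i \<in> I" "x \<in> E i" using assms(2) by blast
      moreover from \<open>i \<in> I\<close> have "i \<in> e ` {..<card I}" using e by (simp add: bij_betw_def)
      then obtain n where "n < card I" "e n = i" by auto
      ultimately have "x \<in> E' n" by (simp add: E'_def)
      then show "x \<in> (\<Union>i. E' i)" by blast
    qed
  qed (use assms eI in \<open>auto simp: E'_def\<close>)
  also have "\<dots> = (\<Sum>n<card I. hausdorff_weight k (E' n))"
    by (rule suminf_finite) (auto simp: E'_def)
  also have "\<dots> = (\<Sum>n<card I. hausdorff_weight k (E (e n)))" by (simp add: E'_def)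
  also have "\<dots> = (\<Sum>i\<in>I. hausdorff_weight k (E i))"
    by (rule sum.reindex_bij_betw[OF e])
  finally show ?thesis .
qed

text \<open>Each \<open>A n\<close> is covered with an excess below \<open>e / 2 ^ Suc n\<close>,
  and \<open>prod_decode\<close> enumerates the double sequence of covering sets, which keeps the
  mesh bound.\<close>

lemma hausdorff_delta_countably_subadditive:
  fixes A :: "nat \<Rightarrow> 'a::euclidean_space set"
  shows "hausdorff_delta k \<delta> (\<Union>n. A n) \<le> (\<Sum>n. hausdorff_delta k \<delta> (A n))"
proof (rule ennreal_le_epsilon)
  let ?H = "hausdorff_delta k \<delta>"
  fix e :: real assume "0 < e" "(\<Sum>n. ?H (A n)) < top"
  then have *: "?H (A n) < ?H (A n) + e * (1/2)^Suc n" for n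
    by (auto simp add: less_top dest!: ennreal_suminf_lessD)
  have "\<exists>E. A n \<subseteq> (\<Union>i. E i) \<and> (\<forall>i. bounded (E i)) \<and> (\<forall>i. diameter (E i) \<le> \<delta>) \<and>
      (\<Sum>i. hausdorff_weight k (E i)) < ?H (A n) + e * (1/2)^Suc n" for n
    using hausdorff_delta_approx[OF *[of n]] by metis
  then obtain E where E: "\<And>n. A n \<subseteq> (\<Union>i. E n i)" "\<And>n i. bounded (E n i)" "\<And>n i. diameter (E n i) \<le> \<delta>"
    and Ele: "\<And>n. (\<Sum>i. hausdorff_weight k (E n i)) < ?H (A n) + e * (1/2)^Suc n"
    by metis
  define C where "C = case_prod E \<circ> prod_decode"
  have "?H (\<Union>n. A n) \<le> (\<Sum>i. hausdorff_weight k (C i))"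
  proof (rule hausdorff_delta_le)
    show "(\<Union>n. A n) \<subseteq> (\<Union>i. C i)"
    proof
      fix x assume "x \<in> (\<Union>n. A n)"
      then obtain n i where "x \<in> E n i" using E(1) by blast
      then have "x \<in> C (prod_encode (n, i))" by (simp add: C_def)
      then show "x \<in> (\<Union>i. C i)" by blast
    qed
  qed (use E in \<open>auto simp: C_def split: prod.split\<close>)
  also have "\<dots> = (\<Sum>n. \<Sum>i. hausdorff_weight k (E n i))"
    using suminf_ennreal_2dimen[of "\<lambda>n. \<Sum>i. hausdorff_weight k (E n i)" "\<lambda>(n, i). hausdorff_weight k (E n i)"]
    by (simp add: C_def comp_def split_def)
  also have "\<dots> \<le> (\<Sum>n. ?H (A n) + e * (1/2) ^ Suc n)"
    by (intro suminf_le summableI less_imp_le[OF Ele])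
  also have "... = (\<Sum>n. ?H (A n)) + (\<Sum>n. ennreal e * ennreal ((1/2) ^ Suc n))"
    using \<open>0 < e\<close> by (subst suminf_add[symmetric])
      (auto simp del: ennreal_suminf_cmult simp add: ennreal_mult[symmetric])
  also have "\<dots> = (\<Sum>n. ?H (A n)) + e"
    unfolding ennreal_suminf_cmult
    by (subst suminf_ennreal_eq[OF zero_le_power power_half_series]) auto
  finally show "?H (\<Union>n. A n) \<le> (\<Sum>n. ?H (A n)) + e" .
qed

section \<open>The limit of vanishing mesh as a metric outer measure\<close>

lemma hausdorff_outer_upper: "\<delta> > 0 \<Longrightarrow> hausdorff_delta k \<delta> A \<le> hausdorff_outer k A"
  unfolding hausdorff_outer_def by (rule SUP_upper) simp

lemma hausdorff_outer_mono: "A \<subseteq> B \<Longrightarrow> hausdorff_outer k A \<le> hausdorff_outer k B"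
  unfolding hausdorff_outer_def by (rule SUP_mono) (auto intro: hausdorff_delta_mono)

lemma outer_measure_space_hausdorff_outer:
  "outer_measure_space (Pow UNIV) (hausdorff_outer k :: 'a::euclidean_space set \<Rightarrow> ennreal)"
    (is "outer_measure_space _ ?H")
  unfolding outer_measure_space_def
proof (intro conjI)
  show "positive (Pow UNIV) ?H"
    by (simp add: positive_def hausdorff_outer_def hausdorff_delta_empty)
  show "increasing (Pow UNIV) ?H"
    by (simp add: increasing_def hausdorff_outer_mono)
  show "countably_subadditive (Pow UNIV) ?H"
    unfolding countably_subadditive_def
  proof (intro allI impI)
    fix A :: "nat \<Rightarrow> 'a set"
    show "hausdorff_outer k (\<Union>i. A i) \<le> (\<Sum>i. hausdorff_outer k (A i))"
      unfolding hausdorff_outer_def[of k "\<Union>i. A i"]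
    proof (rule SUP_least)
      fix \<delta> :: real assume "\<delta> \<in> {0<..}"
      then show "hausdorff_delta k \<delta> (\<Union>i. A i) \<le> (\<Sum>i. hausdorff_outer k (A i))"
        by (intro order_trans[OF hausdorff_delta_countably_subadditive] suminf_le summableI
            hausdorff_outer_upper) auto
    qed
  qed
qed

text \<open>Once the mesh is below \<open>e\<close>, no covering set meets both \<open>A\<close> and
  \<open>B\<close>, so a cover of the union splits into two covers that share no nonempty set of the
  family.\<close>

lemma hausdorff_outer_metric:
  assumes "e > 0" and sep: "\<And>x y. x \<in> A \<Longrightarrow> y \<in> B \<Longrightarrow> e \<le> dist x y"
  shows "hausdorff_outer k (A \<union> B) = hausdorff_outer k A + hausdorff_outer k B"
proof (rule antisym)
  show "hausdorff_outer k (A \<union> B) \<le> hausdorff_outer k A + hausdorff_outer k B"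
  proof -
    have "A \<inter> B = {}" using sep \<open>e > 0\<close> by force
    moreover have "subadditive (Pow UNIV) (hausdorff_outer k)"
      using outer_measure_space_hausdorff_outer[of k]
        algebra.axioms(1)[OF sigma_algebra.axioms(1)[OF sigma_algebra_Pow]]
      by (metis outer_measure_space_def ring_of_sets.countably_subadditive_subadditive)
    ultimately show ?thesis by (auto simp: subadditive_def)
  qed
  have sum_le: "hausdorff_delta k \<delta> A + hausdorff_delta k \<delta> B \<le> hausdorff_delta k \<delta> (A \<union> B)"
    if "\<delta> < e" "\<delta> > 0" for \<delta>
  proof (rule hausdorff_delta_greatest)
    fix E :: "nat \<Rightarrow> _ set"
    assume E: "A \<union> B \<subseteq> (\<Union>i. E i)" "\<And>i. bounded (E i)" "\<And>i. diameter (E i) \<le> \<delta>"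
    let ?w = "hausdorff_weight k"
    \<comment> \<open>Sets that miss \<open>S\<close> are emptied rather than dropped, which keeps
      the indexing and costs weight 0.\<close>
    define F where "F S i = (if E i \<inter> S = {} then {} else E i)" for S i
    have F: "hausdorff_delta k \<delta> S \<le> (\<Sum>i. ?w (F S i))" if S: "S \<subseteq> A \<union> B" for S
    proof (rule hausdorff_delta_le)
      show "S \<subseteq> (\<Union>i. F S i)"
      proof
        fix x assume x: "x \<in> S"
        then obtain i where "x \<in> E i" using S E(1) by blast
        then have "x \<in> F S i" using x by (auto simp: F_def)
        then show "x \<in> (\<Union>i. F S i)" by blast
      qed
    qed (use E \<open>\<delta> > 0\<close> in \<open>auto simp: F_def\<close>)
    have "?w (F A i) + ?w (F B i) \<le> ?w (E i)" for i
    proof -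
      have "E i \<inter> A = {} \<or> E i \<inter> B = {}"
      proof (rule ccontr)
        assume "\<not> ?thesis"
        then obtain x y where xy: "x \<in> E i" "x \<in> A" "y \<in> E i" "y \<in> B" by blast
        then have "dist x y \<le> \<delta>" using diameter_bounded_bound[OF E(2)] E(3) order_trans by blast
        then show False using sep[OF xy(2,4)] \<open>\<delta> < e\<close> by simp
      qed
      then show ?thesis by (auto simp: F_def)
    qed
    then have "(\<Sum>i. ?w (F A i) + ?w (F B i)) \<le> (\<Sum>i. ?w (E i))"
      by (intro suminf_le summableI)
    moreover have "(\<Sum>i. ?w (F A i) + ?w (F B i)) = (\<Sum>i. ?w (F A i)) + (\<Sum>i. ?w (F B i))"
      by (rule suminf_add[symmetric]) (rule summableI)+
    ultimately show "hausdorff_delta k \<delta> A + hausdorff_delta k \<delta> B \<le> (\<Sum>i. ?w (E i))"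
      using add_mono[OF F[of A] F[of B]] by auto
  qed
  \<comment> \<open>\<open>hausdorff_delta\<close> grows as the mesh shrinks, so both suprema can be
    taken along a common mesh.\<close>
  have "hausdorff_outer k A + hausdorff_outer k B = (SUP \<delta>\<in>{0<..}. hausdorff_delta k \<delta> A + hausdorff_delta k \<delta> B)"
    unfolding hausdorff_outer_def
  proof (rule SUP_add_directed_ennreal[symmetric])
    fix i j :: real assume "i \<in> {0<..}" "j \<in> {0<..}"
    then show "\<exists>l\<in>{0<..}. hausdorff_delta k i A + hausdorff_delta k j B \<le> hausdorff_delta k l A + hausdorff_delta k l B"
      by (intro bexI[of _ "min i j"] add_mono hausdorff_delta_antimono) auto
  qed
  also have "\<dots> \<le> hausdorff_outer k (A \<union> B)"
  proof (rule SUP_least)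
    fix \<delta> :: real assume \<delta>: "\<delta> \<in> {0<..}"
    let ?\<eta> = "min \<delta> (e / 2)"
    have "hausdorff_delta k \<delta> A + hausdorff_delta k \<delta> B \<le> hausdorff_delta k ?\<eta> A + hausdorff_delta k ?\<eta> B"
      by (intro add_mono hausdorff_delta_antimono) auto
    also have "\<dots> \<le> hausdorff_delta k ?\<eta> (A \<union> B)"
      using \<delta> \<open>e > 0\<close> by (intro sum_le) auto
    also have "\<dots> \<le> hausdorff_outer k (A \<union> B)"
      using \<delta> \<open>e > 0\<close> by (intro hausdorff_outer_upper) auto
    finally show "hausdorff_delta k \<delta> A + hausdorff_delta k \<delta> B \<le> hausdorff_outer k (A \<union> B)" .
  qed
  finally show "hausdorff_outer k A + hausdorff_outer k B \<le> hausdorff_outer k (A \<union> B)" .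
qed

lemma sets_hausdorff_measure [simp, measurable_cong]: "sets (hausdorff_measure k) = sets borel"
  unfolding hausdorff_measure_def using sets.sigma_sets_eq[of borel]
  by (simp add: sets_measure_of_conv)

text \<open>\<open>measure_of\<close> yields the zero measure unless its set function is a measure
  on the Borel sets; Caratheodory's criterion rules this default out.\<close>

lemma emeasure_hausdorff_measure:
  assumes "A \<in> sets borel"
  shows "emeasure (hausdorff_measure k) A = hausdorff_outer k A"
proof -
  have "measure_space UNIV (sets borel) (hausdorff_outer k :: 'a set \<Rightarrow> ennreal)"
    by (rule metric_outer_measure_space_borel[OF outer_measure_space_hausdorff_outer hausdorff_outer_metric])
  then show ?thesis
    unfolding hausdorff_measure_def hausdorff_outer_def[abs_def]
    by (intro emeasure_measure_of_sigma) (use assms in \<open>auto simp: measure_space_def\<close>)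
qed

text \<open>A cover of \<open>A\<close> is carried to the images of \<open>E i \<inter> A\<close>,
  the part on which the Lipschitz bound holds; diameters grow by at most the factor
  \<open>L\<close>, weights by \<open>L ^ k\<close>, and mesh \<open>\<delta>\<close> becomes
  \<open>L * \<delta>\<close>.\<close>

lemma hausdorff_outer_lipschitz_image:
  fixes f :: "'a::euclidean_space \<Rightarrow> 'b::euclidean_space"
  assumes "L-lipschitz_on A f" "L > 0"
  shows "hausdorff_outer k (f ` A) \<le> ennreal (L ^ k) * hausdorff_outer k A"
  unfolding hausdorff_outer_def[of k "f ` A"]
proof (rule SUP_least)
  fix \<delta>' :: real assume "\<delta>' \<in> {0<..}"
  define \<delta> where "\<delta> = \<delta>' / L"
  have \<delta>: "\<delta> > 0" "\<delta>' = L * \<delta>" using \<open>\<delta>' \<in> _\<close> \<open>L > 0\<close> by (auto simp: \<delta>_def)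
  \<comment> \<open>The factor is moved to the left so that the bound can be proved cover by cover,
    as a lower bound for the infimum on the right.\<close>
  have "hausdorff_delta k \<delta>' (f ` A) / ennreal (L ^ k) \<le> hausdorff_delta k \<delta> A"
  proof (rule hausdorff_delta_greatest)
    fix E :: "nat \<Rightarrow> 'a set"
    assume E: "A \<subseteq> (\<Union>i. E i)" "\<And>i. bounded (E i)" "\<And>i. diameter (E i) \<le> \<delta>"
    have d: "dist (f x) (f y) \<le> L * diameter (E i)" if "x \<in> E i \<inter> A" "y \<in> E i \<inter> A" for x y i
    proof -
      have "dist (f x) (f y) \<le> L * dist x y" using lipschitz_onD[OF assms(1)] that by blast
      also have "\<dots> \<le> L * diameter (E i)"
        using that diameter_bounded_bound[OF E(2)] \<open>L > 0\<close> by (intro mult_left_mono) auto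
      finally show ?thesis .
    qed
    have bd: "bounded (f ` (E i \<inter> A))" for i
    proof (cases "E i \<inter> A = {}")
      case False
      then obtain x where "x \<in> E i \<inter> A" by blast
      then show ?thesis unfolding bounded_def using d by (intro exI[of _ "f x"]) blast
    qed simp
    have dd: "diameter (f ` (E i \<inter> A)) \<le> L * diameter (E i)" for i
      using diameter_ge_0[OF E(2)] \<open>L > 0\<close>
      by (intro diameter_le) (use d in \<open>auto simp: dist_norm\<close>)
    have w: "hausdorff_weight k (f ` (E i \<inter> A)) \<le> ennreal (L ^ k) * hausdorff_weight k (E i)" for i
    proof (cases "E i = {}")
      case False
      have "hausdorff_weight k (f ` (E i \<inter> A)) \<le> ennreal (unit_ball_vol (real k) * (L * diameter (E i) / 2) ^ k)"
        by (rule hausdorff_weight_le[OF bd dd])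
      also have "\<dots> = ennreal (L ^ k) * hausdorff_weight k (E i)"
        using False \<open>L > 0\<close> diameter_ge_0[OF E(2)]
        by (simp add: hausdorff_weight_def ennreal_mult[symmetric] power_mult_distrib power_divide mult_ac)
      finally show ?thesis .
    qed simp
    have "hausdorff_delta k \<delta>' (f ` A) \<le> (\<Sum>i. hausdorff_weight k (f ` (E i \<inter> A)))"
    proof (rule hausdorff_delta_le[OF _ bd])
      show "diameter (f ` (E i \<inter> A)) \<le> \<delta>'" for i
        using dd[of i] mult_left_mono[OF E(3)[of i], of L] \<open>L > 0\<close> \<delta>(2) by linarith
      show "f ` A \<subseteq> (\<Union>i. f ` (E i \<inter> A))" using E(1) by blast
    qed
    also have "\<dots> \<le> (\<Sum>i. ennreal (L ^ k) * hausdorff_weight k (E i))"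
      by (intro suminf_le summableI w)
    finally have "hausdorff_delta k \<delta>' (f ` A) \<le> ennreal (L ^ k) * (\<Sum>i. hausdorff_weight k (E i))" by simp
    then show "hausdorff_delta k \<delta>' (f ` A) / ennreal (L ^ k) \<le> (\<Sum>i. hausdorff_weight k (E i))"
      using \<open>L > 0\<close> by (intro divide_le_posI_ennreal) auto
  qed
  also have "\<dots> \<le> hausdorff_outer k A" by (rule hausdorff_outer_upper[OF \<delta>(1)])
  finally have "hausdorff_delta k \<delta>' (f ` A) / ennreal (L ^ k) * ennreal (L ^ k) \<le> hausdorff_outer k A * ennreal (L ^ k)"
    by (rule mult_right_mono) simp
  moreover have "hausdorff_delta k \<delta>' (f ` A) / ennreal (L ^ k) * ennreal (L ^ k) = hausdorff_delta k \<delta>' (f ` A)"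
    using \<open>L > 0\<close> by (simp add: ennreal_divide_times ennreal_times_divide[symmetric])
  ultimately show "hausdorff_delta k \<delta>' (f ` A) \<le> ennreal (L ^ k) * hausdorff_outer k A"
    by (simp add: mult.commute)
qed

subsection \<open>Flat cubes\<close>

text \<open>A cube of dimension one less than the space, placed in a coordinate hyperplane, so that
  no type of vectors of the smaller dimension is involved.\<close>

definition flat_cube :: "'m \<Rightarrow> real \<Rightarrow> (real ^ 'm) set" where
  "flat_cube k R = {y. y $ k = 0 \<and> (\<forall>j. \<bar>y $ j\<bar> \<le> R)}"

text \<open>A grid of width \<open>R / N\<close> cuts the cube into at most
  \<open>(2 * N + 1) ^ (m - 1)\<close> cells of diameter at most \<open>m * R / N\<close>, where
  \<open>m = CARD('m)\<close>; the powers of \<open>N\<close> cancel, which leaves a bound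
  independent of the mesh.\<close>

lemma hausdorff_outer_flat_cube_finite:
  fixes k :: "'m::finite"
  assumes "R > 0"
  shows "hausdorff_outer (CARD('m) - 1) (flat_cube k R) < top"
proof -
  let ?K = "CARD('m) - 1"
  let ?m = "real CARD('m)"
  \<comment> \<open>The constant collects \<open>2 * N + 1 \<le> 3 * N\<close> cells per direction
    and half the cell diameter \<open>m * R / N\<close>.\<close>
  let ?b = "unit_ball_vol (real ?K) * (3 * ?m * R / 2) ^ ?K"
  have "hausdorff_delta ?K \<delta> (flat_cube k R) \<le> ennreal ?b" if "\<delta> > 0" for \<delta>
  proof -
    obtain N where "?m * R / \<delta> < real N" using reals_Archimedean2 by blast
    then have *: "?m * R < real N * \<delta>" using \<open>\<delta> > 0\<close> by (simp add: pos_divide_less_eq)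
    have "0 < ?m * R" using \<open>R > 0\<close> by simp
    with * have "0 < real N * \<delta>" by linarith
    then have "N > 0" using \<open>\<delta> > 0\<close> by (simp add: zero_less_mult_iff)
    with * have N: "N > 0" "?m * (R / N) \<le> \<delta>" by (auto simp: pos_divide_le_eq mult.commute)
    define s where "s = R / N"
    have s: "s > 0" using N \<open>R > 0\<close> by (simp add: s_def)
    define I :: "('m \<Rightarrow> int) set" where "I = PiE (UNIV - {k}) (\<lambda>_. {- int N..int N})"
    define E where "E i = {y :: real ^ 'm. y $ k = 0 \<and> (\<forall>j\<in>UNIV - {k}. \<lfloor>y $ j / s\<rfloor> = i j)}" for i
    have fin: "finite I" unfolding I_def by (intro finite_PiE) auto
    have card: "card I = (2 * N + 1) ^ ?K"
    proof -
      have "card {- int N..int N} = 2 * N + 1" by simp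
      then show ?thesis unfolding I_def by (subst card_PiE) (auto simp del: card_atLeastAtMost_int)
    qed
    have cover: "flat_cube k R \<subseteq> (\<Union>i\<in>I. E i)"
    proof
      fix y assume y: "y \<in> flat_cube k R"
      define i where "i = restrict (\<lambda>j. \<lfloor>y $ j / s\<rfloor>) (UNIV - {k})"
      have "\<lfloor>y $ j / s\<rfloor> \<in> {- int N..int N}" for j
      proof -
        have "\<bar>y $ j\<bar> \<le> N * s" using y N by (simp add: flat_cube_def s_def)
        then have "- real N \<le> y $ j / s \<and> y $ j / s \<le> real N" using s by (auto simp: field_simps)
        then show ?thesis by (auto simp: le_floor_iff floor_le_iff)
      qed
      then have "i \<in> I" by (auto simp: I_def i_def)
      moreover have "y \<in> E i" using y by (auto simp: E_def i_def flat_cube_def)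
      ultimately show "y \<in> (\<Union>i\<in>I. E i)" by blast
    qed
    have d: "norm (x - y) \<le> ?m * s" if "x \<in> E i" "y \<in> E i" for x y i
    proof -
      have "\<bar>(x - y) $ j\<bar> \<le> s" for j
      proof (cases "j = k")
        case False
        then have "\<lfloor>x $ j / s\<rfloor> = \<lfloor>y $ j / s\<rfloor>" using that by (auto simp: E_def)
        then have "\<bar>x $ j / s - y $ j / s\<bar> \<le> 1" by linarith
        then have "\<bar>(x $ j - y $ j) / s\<bar> \<le> 1" by (simp add: diff_divide_distrib)
        then show ?thesis using s by (simp add: abs_divide)
      qed (use that s in \<open>auto simp: E_def\<close>)
      then have "(\<Sum>j\<in>UNIV. \<bar>(x - y) $ j\<bar>) \<le> ?m * s"
        using sum_bounded_above[of UNIV "\<lambda>j. \<bar>(x - y) $ j\<bar>" s] by simp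
      then show ?thesis using norm_le_l1_cart[of "x - y"] by linarith
    qed
    have bd: "bounded (E i)" for i
    proof (cases "E i = {}")
      case False
      then obtain x where "x \<in> E i" by blast
      then show ?thesis unfolding bounded_def using d by (intro exI[of _ x]) (auto simp: dist_norm)
    qed simp
    have dd: "diameter (E i) \<le> ?m * s" for i
      using s d by (intro diameter_le) auto
    have "hausdorff_delta ?K \<delta> (flat_cube k R) \<le> (\<Sum>i\<in>I. hausdorff_weight ?K (E i))"
      by (rule hausdorff_delta_finite_cover[OF fin cover bd])
        (use dd N \<open>\<delta> > 0\<close> order_trans in \<open>auto simp: s_def\<close>)
    also have "\<dots> \<le> (\<Sum>i\<in>I. ennreal (unit_ball_vol (real ?K) * (?m * s / 2) ^ ?K))"
      by (intro sum_mono hausdorff_weight_le[OF bd dd])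
    also have "\<dots> = ennreal (real (card I) * (unit_ball_vol (real ?K) * (?m * s / 2) ^ ?K))"
      using s by (simp add: ennreal_mult ennreal_of_nat_eq_real_of_nat)
    also have "\<dots> \<le> ennreal ?b"
    proof (rule ennreal_leI)
      have "real (card I) \<le> real (3 * N) ^ ?K"
        using N unfolding card of_nat_power by (intro power_mono) auto
      then have "real (card I) * (unit_ball_vol (real ?K) * (?m * s / 2) ^ ?K)
          \<le> real (3 * N) ^ ?K * (unit_ball_vol (real ?K) * (?m * s / 2) ^ ?K)"
        using s by (intro mult_right_mono) auto
      also have "\<dots> = unit_ball_vol (real ?K) * (real (3 * N) * (?m * s / 2)) ^ ?K"
        by (simp only: power_mult_distrib[of "real (3 * N)" "?m * s / 2"] mult.left_commute)
      also have "real (3 * N) * (?m * s / 2) = 3 * ?m * R / 2" using N by (simp add: s_def)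
      finally show "real (card I) * (unit_ball_vol (real ?K) * (?m * s / 2) ^ ?K) \<le> ?b" .
    qed
    finally show ?thesis .
  qed
  then have "hausdorff_outer ?K (flat_cube k R) \<le> ennreal ?b"
    unfolding hausdorff_outer_def by (intro SUP_least) auto
  then show ?thesis by (simp add: order_le_less_trans)
qed

text \<open>The side in direction \<open>k\<close> has length 1 and drops out of the product. In
  dimension 1 with \<open>r = 0\<close> the value is \<open>0 ^ 0 = 1\<close>, in accordance with
  the weight of a singleton.\<close>

lemma emeasure_lborel_slab:
  fixes k :: "'m::finite" and x :: "real ^ 'm"
  assumes "r \<ge> 0"
  shows "emeasure lborel (cbox (\<chi> j. if j = k then 0 else x $ j - r) (\<chi> j. if j = k then 1 else x $ j + r))
    = ennreal ((2 * r) ^ (CARD('m) - 1))" (is "emeasure lborel (cbox ?a ?b) = _")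
proof -
  have "cbox ?a ?b \<noteq> {}" using assms by (auto simp: interval_ne_empty_cart)
  then have "measure lborel (cbox ?a ?b) = (\<Prod>i\<in>UNIV. ?b $ i - ?a $ i)" by (rule content_cbox_cart)
  also have "\<dots> = (\<Prod>i\<in>UNIV. if i = k then 1 else 2 * r)" by (intro prod.cong) auto
  also have "\<dots> = (\<Prod>i\<in>UNIV - {k}. 2 * r)" by (subst prod.remove[of _ k]) auto
  also have "\<dots> = (2 * r) ^ (CARD('m) - 1)" by simp
  finally show ?thesis using emeasure_lborel_cbox_finite[of ?a ?b]
    by (simp add: emeasure_eq_ennreal_measure less_top[symmetric])
qed

text \<open>Thickening a cover of the cube by a unit interval in the direction \<open>k\<close> gives a cover of a full
  dimensional box, whose Lebesgue measure bounds the sum of the weights from below.\<close>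

lemma hausdorff_outer_flat_cube_pos:
  fixes k :: "'m::finite"
  assumes "R > 0"
  shows "hausdorff_outer (CARD('m) - 1) (flat_cube k R) > 0"
proof -
  let ?K = "CARD('m) - 1"
  \<comment> \<open>A nonempty set of diameter \<open>d\<close> has weight
    \<open>unit_ball_vol K * (d / 2) ^ K\<close>, while its thickened box has sides
    \<open>2 * d\<close> around one of its points; \<open>4 ^ K\<close> is the ratio of the two
    powers.\<close>
  let ?c = "unit_ball_vol (real ?K) / 4 ^ ?K"
  define slab where "slab x r = cbox (\<chi> j. if j = k then 0 else x $ j - r) (\<chi> j. if j = k then 1 else x $ j + r)"
    for x :: "real ^ 'm" and r
  have c: "?c > 0" by simp
  \<comment> \<open>Mesh 1 is an arbitrary choice: the volume bound holds for every cover, and each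
    mesh bounds the outer measure from below.\<close>
  have "ennreal (?c * (2 * R) ^ ?K) \<le> hausdorff_delta ?K 1 (flat_cube k R)"
  proof (rule hausdorff_delta_greatest)
    fix E :: "nat \<Rightarrow> (real ^ 'm) set"
    assume E: "flat_cube k R \<subseteq> (\<Union>i. E i)" "\<And>i. bounded (E i)" "\<And>i. diameter (E i) \<le> 1"
    define x where "x i = (SOME x. x \<in> E i)" for i
    define C where "C i = (if E i = {} then {} else slab (x i) (diameter (E i)))" for i
    have "slab 0 R \<subseteq> (\<Union>i. C i)"
    proof
      fix y assume y: "y \<in> slab 0 R"
      define z where "z = (\<chi> j. if j = k then 0 else y $ j)"
      have "z \<in> flat_cube k R"
        using y \<open>R > 0\<close> by (auto simp: z_def flat_cube_def slab_def mem_box_cart abs_le_iff split: if_splits)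
      then obtain i where i: "z \<in> E i" using E(1) by blast
      then have xi: "x i \<in> E i" unfolding x_def by (rule someI)
      have "\<bar>y $ j - x i $ j\<bar> \<le> diameter (E i)" if "j \<noteq> k" for j
      proof -
        have "\<bar>(z - x i) $ j\<bar> \<le> norm (z - x i)" by (rule component_le_norm_cart)
        also have "\<dots> \<le> diameter (E i)"
          using diameter_bounded_bound[OF E(2) i xi] by (simp add: dist_norm)
        finally show ?thesis using that by (simp add: z_def)
      qed
      then have "y \<in> C i"
        using y i by (fastforce simp: C_def slab_def mem_box_cart abs_le_iff split: if_splits)
      then show "y \<in> (\<Union>i. C i)" by blast
    qed
    then have "emeasure lborel (slab 0 R) \<le> emeasure lborel (\<Union>i. C i)"
      by (intro emeasure_mono) (auto simp: C_def slab_def)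
    also have "\<dots> \<le> (\<Sum>i. emeasure lborel (C i))"
      by (intro emeasure_subadditive_countably) (auto simp: C_def slab_def)
    finally have "ennreal ?c * emeasure lborel (slab 0 R) \<le> ennreal ?c * (\<Sum>i. emeasure lborel (C i))"
      by (rule mult_left_mono) simp
    also have "\<dots> = (\<Sum>i. ennreal ?c * emeasure lborel (C i))" by simp
    also have "\<dots> = (\<Sum>i. hausdorff_weight ?K (E i))"
    proof (intro suminf_cong)
      fix i
      let ?d = "diameter (E i)"
      show "ennreal ?c * emeasure lborel (C i) = hausdorff_weight ?K (E i)"
      proof (cases "E i = {}")
        case False
        have d: "?d \<ge> 0" by (rule diameter_ge_0[OF E(2)])
        have "ennreal ?c * emeasure lborel (C i) = ennreal ?c * ennreal ((2 * ?d) ^ ?K)"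
          using False emeasure_lborel_slab[OF d, of k "x i"] by (simp add: C_def slab_def)
        also have "\<dots> = ennreal (?c * (2 * ?d) ^ ?K)"
          by (rule ennreal_mult[symmetric]) (use d in auto)
        also have "?c * (2 * ?d) ^ ?K = unit_ball_vol (real ?K) * ((2 * ?d) / 4) ^ ?K"
          unfolding power_divide by (simp only: times_divide_eq_left times_divide_eq_right)
        also have "ennreal \<dots> = hausdorff_weight ?K (E i)"
          using False by (simp add: hausdorff_weight_def)
        finally show ?thesis .
      qed (simp add: C_def)
    qed
    also have "ennreal ?c * emeasure lborel (slab 0 R) = ennreal (?c * (2 * R) ^ ?K)"
    proof -
      have "emeasure lborel (slab 0 R) = ennreal ((2 * R) ^ ?K)"
        unfolding slab_def by (rule emeasure_lborel_slab) (use \<open>R > 0\<close> in simp)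
      then show ?thesis using \<open>R > 0\<close> by (simp only: ennreal_mult[symmetric]) (subst ennreal_mult[symmetric], auto)
    qed
    finally show "ennreal (?c * (2 * R) ^ ?K) \<le> (\<Sum>i. hausdorff_weight ?K (E i))" .
  qed
  also have "\<dots> \<le> hausdorff_outer ?K (flat_cube k R)" by (rule hausdorff_outer_upper) simp
  finally have le: "ennreal (?c * (2 * R) ^ ?K) \<le> hausdorff_outer ?K (flat_cube k R)" .
  have "0 < ?c * (2 * R) ^ ?K" using c \<open>R > 0\<close> by (intro mult_pos_pos zero_less_power) auto
  then have "0 < ennreal (?c * (2 * R) ^ ?K)" by (simp only: ennreal_less_zero_iff)
  then show ?thesis using le by (rule order_less_le_trans)
qed

section \<open>Geometry of smooth bounded domains\<close>

text \<open>The partial derivatives are continuous, hence bounded on the compact ball, and convexity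
  of the ball turns the derivative bound into a Lipschitz constant. Applied to \<open>h\<close>, it
  makes the local graph map Lipschitz.\<close>

lemma smooth_on_lipschitz_on_cball:
  fixes h :: "'a::euclidean_space \<Rightarrow> real"
  assumes "smooth_on UNIV h"
  obtains L where "L-lipschitz_on (cball c \<rho>) h"
proof -
  have "\<exists>M. \<forall>x\<in>cball c \<rho>. \<bar>frechet_derivative h (at x) b\<bar> \<le> M" if "b \<in> Basis" for b
  proof -
    have "smooth_on UNIV (iter_partial [b] h)"
      using assms that by (intro smooth_on_iter_partial) auto
    then have "continuous_on (cball c \<rho>) (\<lambda>x. frechet_derivative h (at x) b)"
      using smooth_on_continuous_on continuous_on_subset by fastforce
    then have "bounded ((\<lambda>x. frechet_derivative h (at x) b) ` cball c \<rho>)"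
      by (intro compact_imp_bounded compact_continuous_image) auto
    then show ?thesis by (auto simp: bounded_iff)
  qed
  then obtain M where M: "\<And>b x. b \<in> Basis \<Longrightarrow> x \<in> cball c \<rho> \<Longrightarrow> \<bar>frechet_derivative h (at x) b\<bar> \<le> M b"
    by metis
  have M0: "\<bar>frechet_derivative h (at x) v\<bar> \<le> (\<Sum>b\<in>Basis. \<bar>M b\<bar>) * norm v" if "x \<in> cball c \<rho>" for x v
  proof -
    have "(h has_derivative frechet_derivative h (at x)) (at x)"
      using smooth_on_differentiable[OF assms] frechet_derivative_works by blast
    then interpret linear "frechet_derivative h (at x)" by (rule has_derivative_linear)
    have "frechet_derivative h (at x) v = frechet_derivative h (at x) (\<Sum>b\<in>Basis. (v \<bullet> b) *\<^sub>R b)"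
      by (simp add: euclidean_representation)
    also have "\<dots> = (\<Sum>b\<in>Basis. (v \<bullet> b) * frechet_derivative h (at x) b)"
      by (simp add: sum scaleR)
    also have "\<bar>\<dots>\<bar> \<le> (\<Sum>b\<in>Basis. \<bar>(v \<bullet> b) * frechet_derivative h (at x) b\<bar>)"
      by (rule sum_abs)
    also have "\<dots> \<le> (\<Sum>b\<in>Basis. norm v * \<bar>M b\<bar>)"
      unfolding abs_mult
      by (intro sum_mono mult_mono) (auto intro: Basis_le_norm order_trans[OF M[OF _ that] abs_ge_self])
    finally show ?thesis by (simp add: sum_distrib_left mult.commute)
  qed
  have "(\<Sum>b\<in>Basis. \<bar>M b\<bar>)-lipschitz_on (cball c \<rho>) h"
  proof (rule lipschitz_onI)
    fix x y assume "x \<in> cball c \<rho>" "y \<in> cball c \<rho>"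
    then show "dist (h x) (h y) \<le> (\<Sum>b\<in>Basis. \<bar>M b\<bar>) * dist x y"
      unfolding dist_norm
    proof (intro differentiable_bound[where S = "cball c \<rho>"])
      fix z assume "z \<in> cball c \<rho>"
      show "(h has_derivative frechet_derivative h (at z)) (at z within cball c \<rho>)"
        using smooth_on_differentiable[OF assms] frechet_derivative_works has_derivative_at_withinI by blast
      show "onorm (frechet_derivative h (at z)) \<le> (\<Sum>b\<in>Basis. \<bar>M b\<bar>)"
        by (intro onorm_le) (use M0[OF \<open>z \<in> _\<close>] in auto)
    qed auto
  qed (simp add: sum_nonneg)
  then show thesis using that by blast
qed

text \<open>For a unit vector \<open>n\<close> this is the orthogonal projection onto the hyperplane
  normal to \<open>n\<close>, the argument of \<open>h\<close> in
  \<open>smooth_bounded_domain\<close>.\<close>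

definition hyper_proj :: "'a::real_inner \<Rightarrow> 'a \<Rightarrow> 'a" where
  "hyper_proj n x = x - (x \<bullet> n) *\<^sub>R n"

lemma linear_hyper_proj: "linear (hyper_proj n)"
  by (rule linearI) (simp_all add: hyper_proj_def inner_add_left scaleR_add_left algebra_simps)

lemma hyper_proj_inner: "norm n = 1 \<Longrightarrow> hyper_proj n x \<bullet> n = 0"
  by (simp add: hyper_proj_def inner_diff_left flip: power2_norm_eq_inner)

lemma hyper_proj_add_normal: "norm n = 1 \<Longrightarrow> hyper_proj n (x + t *\<^sub>R n) = hyper_proj n x"
  by (simp add: hyper_proj_def inner_add_left scaleR_add_left flip: power2_norm_eq_inner)

lemma hyper_proj_id: "q \<bullet> n = 0 \<Longrightarrow> hyper_proj n q = q"
  by (simp add: hyper_proj_def)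

text \<open>The triangle inequality loses a factor 2 against the sharp bound, which is harmless for
  finiteness and positivity.\<close>

lemma norm_hyper_proj_le: "norm n = 1 \<Longrightarrow> norm (hyper_proj n x) \<le> 2 * norm x"
  using norm_triangle_ineq4[of x "(x \<bullet> n) *\<^sub>R n"] Cauchy_Schwarz_ineq2[of x n]
  by (simp add: hyper_proj_def)

lemma continuous_hyper_proj: "continuous_on S (hyper_proj n)" for n :: "'a::euclidean_space"
  using linear_hyper_proj linear_continuous_on linear_conv_bounded_linear by blast

locale boundary_chart =
  fixes B :: "'a::euclidean_space set" and p n :: 'a and r :: real and h :: "'a \<Rightarrow> real"
  assumes closed: "closed B" and unit: "norm n = 1" and r: "r > 0" and smooth: "smooth_on UNIV h"
    and local: "B \<inter> ball p r = {x \<in> ball p r. x \<bullet> n \<le> h (hyper_proj n x)}"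
begin

lemma continuous_h: "continuous_on S h"
  using smooth_on_continuous_on[OF smooth] continuous_on_subset by blast

lemma below_interior: "x \<in> ball p r \<Longrightarrow> x \<bullet> n < h (hyper_proj n x) \<Longrightarrow> x \<in> interior B"
proof (rule interiorI[of "ball p r \<inter> {x. x \<bullet> n < h (hyper_proj n x)}"])
  have "continuous_on UNIV (\<lambda>x. h (hyper_proj n x))"
    by (rule continuous_on_compose2[OF continuous_h continuous_hyper_proj]) auto
  then show "open (ball p r \<inter> {x. x \<bullet> n < h (hyper_proj n x)})"
    by (intro open_Int open_ball open_Collect_less continuous_intros)
  show "ball p r \<inter> {x. x \<bullet> n < h (hyper_proj n x)} \<subseteq> B" using local by fastforce
qed auto

text \<open>Points strictly below the graph are interior; a point on the graph leaves
  \<open>B\<close> under every small shift along \<open>n\<close>, because the shift raises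
  \<open>x \<bullet> n\<close> but keeps the projection.\<close>

lemma frontier_iff:
  assumes x: "x \<in> ball p r"
  shows "x \<in> frontier B \<longleftrightarrow> x \<bullet> n = h (hyper_proj n x)"
proof
  assume "x \<in> frontier B"
  then have "x \<in> B" "x \<notin> interior B" using closed by (auto simp: frontier_def)
  moreover from \<open>x \<in> B\<close> have "x \<bullet> n \<le> h (hyper_proj n x)" using local x by blast
  ultimately show "x \<bullet> n = h (hyper_proj n x)" using below_interior[OF x] by linarith
next
  assume eq: "x \<bullet> n = h (hyper_proj n x)"
  have "x \<in> B \<inter> ball p r" unfolding local using x eq by simp
  then have xB: "x \<in> B" by blast
  have "x \<notin> interior B"
  proof
    assume "x \<in> interior B"
    then have "x \<in> interior B \<inter> ball p r" using x by simp
    then obtain e where e: "e > 0" "ball x e \<subseteq> interior B \<inter> ball p r"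
      by (meson open_Int open_ball open_contains_ball open_interior)
    have "x + (e / 2) *\<^sub>R n \<in> ball x e" using e(1) unit by (simp add: dist_norm)
    then have "x + (e / 2) *\<^sub>R n \<in> B \<inter> ball p r" using e(2) interior_subset by blast
    then have "(x + (e / 2) *\<^sub>R n) \<bullet> n \<le> h (hyper_proj n (x + (e / 2) *\<^sub>R n))"
      using local by blast
    then have "(x + (e / 2) *\<^sub>R n) \<bullet> n \<le> h (hyper_proj n x)"
      by (simp only: hyper_proj_add_normal[OF unit])
    moreover have "(x + (e / 2) *\<^sub>R n) \<bullet> n = x \<bullet> n + e / 2"
      using unit by (simp add: inner_add_left flip: power2_norm_eq_inner)
    ultimately show False using eq e(1) by simp
  qed
  then show "x \<in> frontier B" using xB by (simp add: frontier_def closure_closed[OF closed])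
qed

end

section \<open>Global consequences of the local charts\<close>

lemma smooth_bounded_domain_chart:
  fixes B :: "'a::euclidean_space set"
  assumes "smooth_bounded_domain B" "p \<in> frontier B"
  obtains n r h where "boundary_chart B p n r h"
proof -
  have "closed B" using assms(1) by (simp add: smooth_bounded_domain_def compact_imp_closed)
  moreover obtain n r and h :: "'a \<Rightarrow> real" where "norm n = 1" "r > 0" "smooth_on UNIV h"
    "B \<inter> ball p r = {x \<in> ball p r. x \<bullet> n \<le> h (x - (x \<bullet> n) *\<^sub>R n)}"
    using assms unfolding smooth_bounded_domain_def by blast
  ultimately have "boundary_chart B p n r h" by (simp add: boundary_chart_def hyper_proj_def)
  then show thesis by (rule that)
qed

text \<open>A boundary point is approached by shifting it along \<open>- n\<close>, strictly below
  the graph. This density gives balls around points of \<open>B\<close> positive volume in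
  \<open>B\<close>, and makes a continuous function on \<open>B\<close> vanish as soon as it
  vanishes in the interior.\<close>

lemma smooth_bounded_domain_subset_closure_interior:
  assumes "smooth_bounded_domain B"
  shows "B \<subseteq> closure (interior B)"
proof
  fix p assume p: "p \<in> B"
  show "p \<in> closure (interior B)"
  proof (cases "p \<in> frontier B")
    case False
    then show ?thesis using p closure_subset by (fastforce simp: frontier_def)
  next
    case True
    then obtain n r h where "boundary_chart B p n r h"
      using smooth_bounded_domain_chart[OF assms] by blast
    then interpret boundary_chart B p n r h .
    show ?thesis unfolding closure_approachable
    proof (intro allI impI)
      fix e :: real assume "e > 0"
      define t where "t = min e r / 2"
      have t: "t > 0" "t < e" "t < r" using \<open>e > 0\<close> r by (auto simp: t_def min_def)
      have "p \<bullet> n = h (hyper_proj n p)" using True r frontier_iff[of p] by simp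
      moreover have "(p + (- t) *\<^sub>R n) \<bullet> n = p \<bullet> n - t"
        using unit by (simp add: inner_diff_left flip: power2_norm_eq_inner)
      ultimately have "p + (- t) *\<^sub>R n \<in> interior B"
        using t unit by (intro below_interior) (simp_all only: hyper_proj_add_normal, auto simp: dist_norm)
      moreover have "dist (p + (- t) *\<^sub>R n) p < e" using t unit by (simp add: dist_norm)
      ultimately show "\<exists>y\<in>interior B. dist y p < e" by blast
    qed
  qed
qed

lemma frontier_subset_smooth_bounded_domain: "smooth_bounded_domain B \<Longrightarrow> frontier B \<subseteq> B"
  by (simp add: smooth_bounded_domain_def compact_imp_closed frontier_subset_closed)

lemma compact_frontier_smooth_bounded_domain: "smooth_bounded_domain B \<Longrightarrow> compact (frontier B)"
  by (simp add: smooth_bounded_domain_def compact_frontier)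

lemma frontier_smooth_bounded_domain_nonempty: "smooth_bounded_domain B \<Longrightarrow> frontier B \<noteq> {}"
proof
  assume B: "smooth_bounded_domain B" and "frontier B = {}"
  then have "B = {} \<or> B = UNIV" by (simp add: frontier_eq_empty)
  then show False using B not_bounded_UNIV compact_imp_bounded
    by (auto simp: smooth_bounded_domain_def)
qed

section \<open>Local finiteness and positivity of the surface measure\<close>

lemma norm_flat_cube_le:
  fixes y :: "real ^ 'm"
  assumes "y \<in> flat_cube k R"
  shows "norm y \<le> real CARD('m) * R"
proof -
  have "(\<Sum>j\<in>UNIV. \<bar>y $ j\<bar>) \<le> real CARD('m) * R"
    using sum_bounded_above[of UNIV "\<lambda>j. \<bar>y $ j\<bar>" R] assms by (auto simp: flat_cube_def)
  then show ?thesis using norm_le_l1_cart[of y] by linarith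
qed

text \<open>An orthogonal map sending \<open>n\<close> to the axis vector \<open>k\<close>, with its
  inverse, identifies the hyperplane normal to \<open>n\<close> with the one containing
  \<open>flat_cube k R\<close>.\<close>

lemma hyperplane_isometry:
  fixes n :: "real ^ 'm" and k :: 'm
  assumes "norm n = 1"
  obtains f g :: "real ^ 'm \<Rightarrow> real ^ 'm" where "linear f" "linear g" "\<And>x. norm (f x) = norm x" "\<And>x. norm (g x) = norm x"
    "\<And>x. g (f x) = x" "\<And>x. f (g x) = x" "\<And>x. f x $ k = x \<bullet> n" "\<And>y. g y \<bullet> n = y $ k"
proof -
  obtain f :: "real ^ 'm \<Rightarrow> real ^ 'm" where f: "orthogonal_transformation f" "f n = axis k 1"
  proof (rule orthogonal_transformation_exists_1)
    show "norm n = 1" by (rule assms)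
    show "norm (axis k 1 :: real ^ 'm) = 1" by simp
  qed
  have bij: "bij f" by (rule orthogonal_transformation_bij[OF f(1)])
  have g: "orthogonal_transformation (inv f)" by (rule orthogonal_transformation_inv[OF f(1)])
  have fk: "f x $ k = x \<bullet> n" for x
  proof -
    have "f x $ k = f x \<bullet> f n" by (simp add: f(2) inner_axis)
    also have "\<dots> = x \<bullet> n" using f(1) by (simp add: orthogonal_transformation_def)
    finally show ?thesis .
  qed
  have fg: "f (inv f x) = x" for x using bij by (simp add: bij_is_surj surj_f_inv_f)
  show thesis
  proof (rule that[of f "inv f"])
    show "inv f y \<bullet> n = y $ k" for y using fk[of "inv f y"] fg by simp
  qed (use f g fk fg bij in \<open>auto simp: orthogonal_transformation_linear orthogonal_transformation_norm bij_is_inj\<close>)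
qed


text \<open>The boundary patch lies in the image of a flat cube under the graph map
  \<open>G\<close>, which has Lipschitz constant \<open>1 + L\<close> there.\<close>

lemma boundary_chart_finite:
  fixes B :: "(real ^ 'm) set"
  assumes "boundary_chart B p n r h"
  shows "hausdorff_outer (CARD('m) - 1) (frontier B \<inter> ball p r) < top"
proof -
  interpret boundary_chart B p n r h by fact
  define k :: 'm where "k = undefined"
  obtain f g where fg: "linear f" "linear g" "\<And>x. norm (f x) = norm x" "\<And>x. norm (g x) = norm x"
    "\<And>x. g (f x) = x" "\<And>x. f (g x) = x" "\<And>x. f x $ k = x \<bullet> n" "\<And>y. g y \<bullet> n = y $ k"
    by (rule hyperplane_isometry[OF unit, of k]) (rule that; assumption)
  \<comment> \<open>Points of \<open>ball p r\<close> have norm at most \<open>norm p + r\<close>;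
    the factor 2 is that of \<open>norm_hyper_proj_le\<close>.\<close>
  define R where "R = 2 * (norm p + r)"
  have R: "R > 0" using r by (simp add: R_def add_nonneg_pos)
  define G where "G y = g y + h (g y) *\<^sub>R n" for y
  obtain L where L: "L-lipschitz_on (cball 0 (real CARD('m) * R)) h"
    using smooth_on_lipschitz_on_cball[OF smooth] by blast
  have L0: "L \<ge> 0" using L by (rule lipschitz_on_nonneg)
  have lip: "(1 + L)-lipschitz_on (flat_cube k R) G"
  proof (rule lipschitz_onI)
    fix x y :: "real ^ 'm" assume xy: "x \<in> flat_cube k R" "y \<in> flat_cube k R"
    have gd: "dist (g x) (g y) = dist x y" by (metis dist_norm fg(2,4) linear_diff)
    have "dist (G x) (G y) \<le> dist (g x) (g y) + dist (h (g x)) (h (g y))"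
    proof -
      have "G x - G y = (g x - g y) + (h (g x) - h (g y)) *\<^sub>R n"
        by (simp add: G_def scaleR_diff_left)
      then show ?thesis using norm_triangle_ineq[of "g x - g y" "(h (g x) - h (g y)) *\<^sub>R n"] unit
        by (simp add: dist_norm)
    qed
    also have "dist (h (g x)) (h (g y)) \<le> L * dist (g x) (g y)"
      by (rule lipschitz_onD[OF L]) (use norm_flat_cube_le xy fg(4) in auto)
    finally show "dist (G x) (G y) \<le> (1 + L) * dist x y" by (simp add: gd distrib_right)
  qed (use L0 in simp)
  have "frontier B \<inter> ball p r \<subseteq> G ` flat_cube k R"
  proof
    fix x assume x: "x \<in> frontier B \<inter> ball p r"
    let ?y = "f (hyper_proj n x)"
    have "norm ?y \<le> R"
    proof -
      have "norm x \<le> norm p + r" using x norm_triangle_ineq2[of x p] by (auto simp: dist_norm norm_minus_commute)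
      then show ?thesis using norm_hyper_proj_le[OF unit, of x] fg(3) by (simp add: R_def)
    qed
    then have "\<bar>?y $ j\<bar> \<le> R" for j using component_le_norm_cart[of ?y j] by linarith
    then have "?y \<in> flat_cube k R" using hyper_proj_inner[OF unit, of x] by (simp add: flat_cube_def fg(7))
    moreover have "G ?y = x"
      using x frontier_iff[of x] by (simp add: G_def fg(5)) (simp add: hyper_proj_def)
    ultimately show "x \<in> G ` flat_cube k R" by (metis imageI)
  qed
  then have "hausdorff_outer (CARD('m) - 1) (frontier B \<inter> ball p r)
      \<le> hausdorff_outer (CARD('m) - 1) (G ` flat_cube k R)"
    by (rule hausdorff_outer_mono)
  also have "\<dots> \<le> ennreal ((1 + L) ^ (CARD('m) - 1)) * hausdorff_outer (CARD('m) - 1) (flat_cube k R)"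
    by (rule hausdorff_outer_lipschitz_image[OF lip]) (use L0 in simp)
  also have "\<dots> < top"
    using hausdorff_outer_flat_cube_finite[OF R, of k] by (simp add: ennreal_mult_less_top)
  finally show ?thesis .
qed

text \<open>The comparison map runs the other way: projecting to the hyperplane is Lipschitz and
  sends the patch onto a set containing a flat cube, so the patch cannot be null.\<close>

lemma boundary_chart_pos:
  fixes B :: "(real ^ 'm) set"
  assumes "boundary_chart B p n r h" and p: "p \<in> frontier B" and "e > 0"
  shows "hausdorff_outer (CARD('m) - 1) (frontier B \<inter> ball p e) > 0"
proof -
  interpret boundary_chart B p n r h by fact
  define k :: 'm where "k = undefined"
  obtain f g where fg: "linear f" "linear g" "\<And>x. norm (f x) = norm x" "\<And>x. norm (g x) = norm x"
    "\<And>x. g (f x) = x" "\<And>x. f (g x) = x" "\<And>x. f x $ k = x \<bullet> n" "\<And>y. g y \<bullet> n = y $ k"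
    by (rule hyperplane_isometry[OF unit, of k]) (rule that; assumption)
  let ?\<pi> = "hyper_proj n"
  \<comment> \<open>The graph point over \<open>q\<close> differs from \<open>p\<close> by a
    tangential part and a change of \<open>h\<close>; each is kept below \<open>e'\<close>, so the
    point stays within \<open>2 * e'\<close> of \<open>p\<close> and inside both
    \<open>ball p e\<close> and \<open>ball p r\<close>.\<close>
  define e' where "e' = min e r / 2"
  have e': "e' > 0" "2 * e' \<le> e" "2 * e' \<le> r" using \<open>e > 0\<close> r by (auto simp: e'_def)
  obtain d where d: "d > 0" "\<And>q. dist q (?\<pi> p) < d \<Longrightarrow> dist (h q) (h (?\<pi> p)) < e'"
    using continuous_h[of UNIV] e'(1) by (metis UNIV_I continuous_on_iff)
  \<comment> \<open>The norm on the cube is at most \<open>CARD('m) * R\<close>; the factor 2 makes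
    the resulting bounds by \<open>d\<close> and \<open>e'\<close> strict.\<close>
  define R where "R = min d e' / (2 * real CARD('m))"
  have R: "R > 0" using d(1) e'(1) by (simp add: R_def)
  have mR: "real CARD('m) * R < d" "real CARD('m) * R < e'"
    using d(1) e'(1) by (auto simp: R_def field_simps min_def)
  define P where "P x = f (?\<pi> x) - f (?\<pi> p)" for x
  have lip: "2-lipschitz_on (frontier B \<inter> ball p e) P"
  proof (rule lipschitz_onI)
    fix x y
    have "P x - P y = f (?\<pi> (x - y))"
      by (simp add: P_def linear_diff[OF fg(1)] linear_diff[OF linear_hyper_proj])
    then show "dist (P x) (P y) \<le> 2 * dist x y"
      using norm_hyper_proj_le[OF unit, of "x - y"] by (simp add: dist_norm fg(3))
  qed simp
  have "flat_cube k R \<subseteq> P ` (frontier B \<inter> ball p e)"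
  proof
    fix y assume y: "y \<in> flat_cube k R"
    define q where "q = g y + ?\<pi> p"
    define x where "x = q + h q *\<^sub>R n"
    have qn: "q \<bullet> n = 0"
      using y hyper_proj_inner[OF unit, of p] by (simp add: q_def inner_add_left fg(8) flat_cube_def)
    have \<pi>x: "?\<pi> x = q" using qn by (simp add: x_def hyper_proj_add_normal[OF unit] hyper_proj_id)
    have xn: "x \<bullet> n = h q" using qn unit by (simp add: x_def inner_add_left flip: power2_norm_eq_inner)
    have ny: "norm y \<le> real CARD('m) * R" using y by (rule norm_flat_cube_le)
    have pp: "p = ?\<pi> p + h (?\<pi> p) *\<^sub>R n"
      using p r frontier_iff[of p] by (simp add: hyper_proj_def)
    have "x - p = g y + (h q - h (?\<pi> p)) *\<^sub>R n"
      by (subst pp) (simp add: x_def q_def scaleR_diff_left)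
    then have "norm (x - p) \<le> norm y + \<bar>h q - h (?\<pi> p)\<bar>"
      using norm_triangle_ineq[of "g y" "(h q - h (?\<pi> p)) *\<^sub>R n"] unit by (simp add: fg(4))
    moreover have "\<bar>h q - h (?\<pi> p)\<bar> < e'"
      using d(2)[of q] ny mR(1) by (simp add: dist_norm q_def fg(4))
    ultimately have "dist p x < 2 * e'" using ny mR(2) by (simp add: dist_norm norm_minus_commute)
    then have "x \<in> frontier B \<inter> ball p e"
      using frontier_iff[of x] e' xn \<pi>x by auto
    moreover have "P x = y"
      by (simp add: P_def \<pi>x q_def linear_add[OF fg(1)] fg(6))
    ultimately show "y \<in> P ` (frontier B \<inter> ball p e)" by blast
  qed
  then have "hausdorff_outer (CARD('m) - 1) (flat_cube k R)
      \<le> hausdorff_outer (CARD('m) - 1) (P ` (frontier B \<inter> ball p e))"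
    by (rule hausdorff_outer_mono)
  also have "\<dots> \<le> ennreal (2 ^ (CARD('m) - 1)) * hausdorff_outer (CARD('m) - 1) (frontier B \<inter> ball p e)"
    by (rule hausdorff_outer_lipschitz_image[OF lip]) simp
  finally show ?thesis using hausdorff_outer_flat_cube_pos[OF R, of k]
    by (metis mult_zero_right not_gr_zero not_le)
qed

abbreviation surface_measure :: "(real ^ 'm) measure" where
  "surface_measure \<equiv> hausdorff_measure (DIM(real ^ 'm) - 1)"

lemma emeasure_surface_measure_frontier_pos:
  fixes B :: "(real ^ 'm) set"
  assumes "smooth_bounded_domain B" "p \<in> frontier B" "e > 0"
  shows "emeasure surface_measure (frontier B \<inter> ball p e) > 0"
proof -
  obtain n r h where "boundary_chart B p n r h"
    using smooth_bounded_domain_chart[OF assms(1,2)] by blast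
  then show ?thesis
    using boundary_chart_pos[OF _ assms(2,3)] by (subst emeasure_hausdorff_measure) auto
qed

lemma emeasure_surface_measure_frontier_finite:
  fixes B :: "(real ^ 'm) set"
  assumes "smooth_bounded_domain B"
  shows "emeasure surface_measure (frontier B) < top"
proof -
  have "\<exists>r>0. emeasure surface_measure (frontier B \<inter> ball p r) < top" if p: "p \<in> frontier B" for p
  proof -
    obtain n r h where c: "boundary_chart B p n r h"
      using smooth_bounded_domain_chart[OF assms p] by blast
    then have "r > 0" by (simp add: boundary_chart_def)
    then show ?thesis
      using boundary_chart_finite[OF c] by (intro exI[of _ r]) (subst emeasure_hausdorff_measure, auto)
  qed
  then obtain r where r: "\<And>p. p \<in> frontier B \<Longrightarrow> r p > 0"
    "\<And>p. p \<in> frontier B \<Longrightarrow> emeasure surface_measure (frontier B \<inter> ball p (r p)) < top"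
    by metis
  obtain D where D: "D \<subseteq> frontier B" "finite D" "frontier B \<subseteq> (\<Union>p\<in>D. ball p (r p))"
  proof (rule compactE_image[OF compact_frontier_smooth_bounded_domain[OF assms], of "frontier B" "\<lambda>p. ball p (r p)"])
    show "frontier B \<subseteq> (\<Union>p\<in>frontier B. ball p (r p))" using r(1) by force
  qed auto
  have "emeasure surface_measure (frontier B) \<le> emeasure surface_measure (\<Union>p\<in>D. frontier B \<inter> ball p (r p))"
  proof (rule emeasure_mono)
    show "(\<Union>p\<in>D. frontier B \<inter> ball p (r p)) \<in> sets surface_measure"
      using D(2) by (intro sets.finite_UN) auto
  qed (use D in blast)
  also have "\<dots> \<le> (\<Sum>p\<in>D. emeasure surface_measure (frontier B \<inter> ball p (r p)))"
    using D(2) by (intro emeasure_subadditive_finite) auto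
  also have "\<dots> < top" using D r(2) by (simp add: subset_iff)
  finally show ?thesis .
qed

section \<open>Nondegeneracy of the pairing\<close>

lemma set_integrable_continuous_on_compact:
  fixes f :: "'a::euclidean_space \<Rightarrow> real"
  assumes M: "sets M = sets borel" and K: "compact K" "emeasure M K < top" and f: "continuous_on K f"
  shows "set_integrable M K f"
proof -
  have "bounded (f ` K)" by (intro compact_imp_bounded compact_continuous_image f K)
  then obtain C where C: "\<And>x. x \<in> K \<Longrightarrow> norm (f x) \<le> C" by (auto simp: bounded_iff)
  have Kb: "K \<in> sets borel" using K(1) by (simp add: borel_compact)
  have m: "(\<lambda>x. indicator K x *\<^sub>R f x) \<in> borel_measurable M"
    using borel_measurable_continuous_on_indicator[OF Kb f] measurable_cong_sets[OF M refl] by blast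
  show ?thesis unfolding set_integrable_def
    by (rule integrableI_bounded_set[where A = K and B = C]) (use m M Kb K C in auto)
qed

text \<open>If the integral vanished, the integrand would vanish almost everywhere, yet by
  continuity it is positive on some \<open>K \<inter> ball p e\<close>, a set of positive measure.
  The general \<open>M\<close> covers both volume and surface integrals.\<close>

lemma set_integral_pos:
  fixes f :: "'a::euclidean_space \<Rightarrow> real"
  assumes M: "sets M = sets borel" and K: "compact K" "emeasure M K < top"
    and f: "continuous_on K f" "\<And>x. x \<in> K \<Longrightarrow> f x \<ge> 0"
    and p: "p \<in> K" "f p > 0" and pos: "\<And>e. e > 0 \<Longrightarrow> emeasure M (K \<inter> ball p e) > 0"
  shows "(LINT x:K|M. f x) > 0"
proof -
  have int: "integrable M (\<lambda>x. indicator K x *\<^sub>R f x)"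
    using set_integrable_continuous_on_compact[OF M K f(1)] by (simp add: set_integrable_def)
  have nonneg: "0 \<le> indicator K x *\<^sub>R f x" for x using f(2) by (simp add: indicator_def)
  have "(LINT x:K|M. f x) \<noteq> 0"
  proof
    assume "(LINT x:K|M. f x) = 0"
    then have ae: "AE x in M. indicator K x *\<^sub>R f x = 0"
      using integral_nonneg_eq_0_iff_AE[OF int] nonneg by (simp add: set_lebesgue_integral_def)
    obtain e where e: "e > 0" "\<And>x. x \<in> K \<Longrightarrow> dist x p < e \<Longrightarrow> dist (f x) (f p) < f p"
      using f(1) p unfolding continuous_on_iff by metis
    have fpos: "f x > 0" if "x \<in> K \<inter> ball p e" for x
      using e(2)[of x] that by (auto simp: dist_commute dist_real_def abs_less_iff)
    from ae have "AE x in M. \<not> x \<in> K \<inter> ball p e"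
    proof (rule eventually_mono)
      show "\<not> x \<in> K \<inter> ball p e" if "indicator K x *\<^sub>R f x = 0" for x
        using that fpos[of x] by (auto simp: indicator_def)
    qed
    then have "emeasure M {x \<in> space M. x \<in> K \<inter> ball p e} = 0" by (rule emeasure_eq_0_AE)
    moreover have "{x \<in> space M. x \<in> K \<inter> ball p e} = K \<inter> ball p e"
      using sets_eq_imp_space_eq[OF M] by auto
    ultimately show False using pos[OF e(1)] by simp
  qed
  moreover have "(LINT x:K|M. f x) \<ge> 0"
    unfolding set_lebesgue_integral_def by (rule integral_nonneg_AE) (use nonneg in auto)
  ultimately show ?thesis by simp
qed

lemma emeasure_lborel_domain_pos:
  assumes "smooth_bounded_domain B" "p \<in> B" "e > 0"
  shows "emeasure lborel (B \<inter> ball p e) > 0"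
proof -
  obtain q where q: "q \<in> interior B" "dist q p < e"
    using smooth_bounded_domain_subset_closure_interior[OF assms(1)] assms(2,3) closure_approachable by blast
  then have "q \<in> interior B \<inter> ball p e" by (simp add: dist_commute)
  then obtain d where d: "d > 0" "ball q d \<subseteq> interior B \<inter> ball p e"
    by (meson open_Int open_ball open_contains_ball open_interior)
  have "0 < emeasure lborel (ball q d)"
    using d(1) by (simp add: emeasure_ball ennreal_less_zero_iff)
  also have "\<dots> \<le> emeasure lborel (B \<inter> ball p e)"
    using d(2) interior_subset assms(1)
    by (intro emeasure_mono) (auto simp: smooth_bounded_domain_def borel_compact)
  finally show ?thesis .
qed

section \<open>Bilinearity of the pairing and positivity of its integrals\<close>

context
  fixes B :: "(real ^ 'm) set"
  assumes B: "smooth_bounded_domain B"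
begin

lemma compact_B: "compact B"
  using B by (simp add: smooth_bounded_domain_def)

lemma Cinf_frontier_continuous_on: "\<phi> \<in> Cinf B \<Longrightarrow> continuous_on (frontier B) \<phi>"
  using Cinf_continuous_on continuous_on_subset frontier_subset_smooth_bounded_domain[OF B] by blast

lemma set_integrable_domain: "continuous_on B f \<Longrightarrow> set_integrable lborel B f" for f :: "_ \<Rightarrow> real"
  using emeasure_bounded_finite[OF compact_imp_bounded[OF compact_B]] compact_B
  by (intro set_integrable_continuous_on_compact) auto

lemma set_integrable_frontier:
  "continuous_on (frontier B) f \<Longrightarrow> set_integrable surface_measure (frontier B) f" for f :: "_ \<Rightarrow> real"
  by (intro set_integrable_continuous_on_compact compact_frontier_smooth_bounded_domain B
      emeasure_surface_measure_frontier_finite) auto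

lemma pairing_Pair:
  "pairing B (\<alpha>, \<alpha>d) \<phi> = (LINT x:B|lborel. \<alpha> x * \<phi> x) + (LINT x:frontier B|surface_measure. \<alpha>d x * \<phi> x)"
  by (simp add: pairing_def surface_integral_def)

text \<open>Additivity of the Bochner integral rests on integrability; here continuity on compact
  sets and finiteness of the boundary measure enter.\<close>

lemma pairing_add_left:
  assumes "\<beta> \<in> Vstar B" "\<beta>' \<in> Vstar B" "\<phi> \<in> V B"
  shows "pairing B (\<beta> + \<beta>') \<phi> = pairing B \<beta> \<phi> + pairing B \<beta>' \<phi>"
proof -
  obtain a b a' b' where eq: "\<beta> = (a, b)" "\<beta>' = (a', b')" by (metis surj_pair)
  have c: "continuous_on B a" "continuous_on B a'" "continuous_on (frontier B) b" "continuous_on (frontier B) b'"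
    "continuous_on B \<phi>" "continuous_on (frontier B) \<phi>"
    using assms Cinf_frontier_continuous_on by (auto simp: eq Vstar_def V_def intro: Cinf_continuous_on)
  have "(LINT x:B|lborel. a x * \<phi> x + a' x * \<phi> x) = (LINT x:B|lborel. a x * \<phi> x) + (LINT x:B|lborel. a' x * \<phi> x)"
    by (intro set_integral_add set_integrable_domain continuous_intros c)
  moreover have "(LINT x:frontier B|surface_measure. b x * \<phi> x + b' x * \<phi> x) =
      (LINT x:frontier B|surface_measure. b x * \<phi> x) + (LINT x:frontier B|surface_measure. b' x * \<phi> x)"
    by (intro set_integral_add set_integrable_frontier continuous_intros c)
  ultimately show ?thesis by (simp add: eq pairing_Pair distrib_right)
qed

lemma pairing_add_right:
  assumes "\<beta> \<in> Vstar B" "\<phi> \<in> V B" "\<phi>' \<in> V B"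
  shows "pairing B \<beta> (\<phi> + \<phi>') = pairing B \<beta> \<phi> + pairing B \<beta> \<phi>'"
proof -
  obtain a b where eq: "\<beta> = (a, b)" by (metis surj_pair)
  have c: "continuous_on B a" "continuous_on (frontier B) b"
    "continuous_on B \<phi>" "continuous_on (frontier B) \<phi>" "continuous_on B \<phi>'" "continuous_on (frontier B) \<phi>'"
    using assms Cinf_frontier_continuous_on by (auto simp: eq Vstar_def V_def intro: Cinf_continuous_on)
  have "(LINT x:B|lborel. a x * \<phi> x + a x * \<phi>' x) = (LINT x:B|lborel. a x * \<phi> x) + (LINT x:B|lborel. a x * \<phi>' x)"
    by (intro set_integral_add set_integrable_domain continuous_intros c)
  moreover have "(LINT x:frontier B|surface_measure. b x * \<phi> x + b x * \<phi>' x) =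
      (LINT x:frontier B|surface_measure. b x * \<phi> x) + (LINT x:frontier B|surface_measure. b x * \<phi>' x)"
    by (intro set_integral_add set_integrable_frontier continuous_intros c)
  ultimately show ?thesis by (simp add: eq pairing_Pair distrib_left)
qed

lemma pairing_scaleR_left: "pairing B (c *\<^sub>R \<beta>) \<phi> = c * pairing B \<beta> \<phi>"
  by (cases \<beta>) (simp add: pairing_Pair scaleR_fun_def mult.assoc distrib_left)

lemma pairing_scaleR_right: "pairing B \<beta> (c *\<^sub>R \<phi>) = c * pairing B \<beta> \<phi>"
  by (cases \<beta>) (simp add: pairing_Pair scaleR_fun_def mult.left_commute distrib_left)

lemma pairing_uminus_left: "pairing B (- \<beta>) \<phi> = - pairing B \<beta> \<phi>"
  using pairing_scaleR_left[of "-1"] by simp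

lemma pairing_uminus_right: "pairing B \<beta> (- \<phi>) = - pairing B \<beta> \<phi>"
  using pairing_scaleR_right[of _ "-1"] by simp

lemma V_0: "0 \<in> V B"
  by (simp add: V_def Cinf_0)

lemma V_uminus: "\<phi> \<in> V B \<Longrightarrow> - \<phi> \<in> V B"
  by (simp add: V_def Cinf_uminus)

lemma V_diff: "\<phi> \<in> V B \<Longrightarrow> \<psi> \<in> V B \<Longrightarrow> \<phi> - \<psi> \<in> V B"
  by (simp add: V_def Cinf_diff)

lemma Vstar_0: "0 \<in> Vstar B"
  by (simp add: Vstar_def Cinf_0 zero_prod_def)

lemma Vstar_uminus: "\<beta> \<in> Vstar B \<Longrightarrow> - \<beta> \<in> Vstar B"
  by (auto simp: Vstar_def Cinf_uminus)

lemma Vstar_diff: "\<beta> \<in> Vstar B \<Longrightarrow> \<gamma> \<in> Vstar B \<Longrightarrow> \<beta> - \<gamma> \<in> Vstar B"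
  by (auto simp: Vstar_def Cinf_diff)

lemma pairing_0_left: "pairing B 0 \<phi> = 0"
  using pairing_scaleR_left[of 0] by simp

lemma pairing_0_right: "pairing B \<beta> 0 = 0"
  using pairing_scaleR_right[of _ 0] by simp

lemma pairing_diff_left:
  "\<beta> \<in> Vstar B \<Longrightarrow> \<beta>' \<in> Vstar B \<Longrightarrow> \<phi> \<in> V B \<Longrightarrow> pairing B (\<beta> - \<beta>') \<phi> = pairing B \<beta> \<phi> - pairing B \<beta>' \<phi>"
  using pairing_add_left[of \<beta> "- \<beta>'" \<phi>] Vstar_uminus by (simp add: pairing_uminus_left)

lemma pairing_diff_right:
  "\<beta> \<in> Vstar B \<Longrightarrow> \<phi> \<in> V B \<Longrightarrow> \<phi>' \<in> V B \<Longrightarrow> pairing B \<beta> (\<phi> - \<phi>') = pairing B \<beta> \<phi> - pairing B \<beta> \<phi>'"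
  using pairing_add_right[of \<beta> \<phi> "- \<phi>'"] V_uminus by (simp add: pairing_uminus_right)

lemma domain_integral_pos:
  fixes f :: "real ^ 'm \<Rightarrow> real"
  assumes "continuous_on B f" "\<And>x. x \<in> B \<Longrightarrow> f x \<ge> 0" "p \<in> B" "f p > 0"
  shows "(LINT x:B|lborel. f x) > 0"
  using emeasure_bounded_finite[OF compact_imp_bounded[OF compact_B]]
  by (intro set_integral_pos[OF _ compact_B _ assms]) (auto intro: emeasure_lborel_domain_pos[OF B] assms)

lemma frontier_integral_pos:
  fixes f :: "real ^ 'm \<Rightarrow> real"
  assumes "continuous_on (frontier B) f" "\<And>x. x \<in> frontier B \<Longrightarrow> f x \<ge> 0" "p \<in> frontier B" "f p > 0"
  shows "(LINT x:frontier B|surface_measure. f x) > 0"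
  by (rule set_integral_pos[OF _ compact_frontier_smooth_bounded_domain[OF B]
        emeasure_surface_measure_frontier_finite[OF B] assms
        emeasure_surface_measure_frontier_pos[OF B assms(3)]]) simp

text \<open>The test element \<open>(\<psi>, 0)\<close> suffices: its pairing with
  \<open>\<psi>\<close> is the integral of the square of \<open>\<psi>\<close> over
  \<open>B\<close>.\<close>

lemma pairing_nondegenerate_right:
  assumes \<psi>: "\<psi> \<in> V B" and zero: "\<And>\<beta>. \<beta> \<in> Vstar B \<Longrightarrow> pairing B \<beta> \<psi> = 0"
  shows "\<psi> = 0"
proof (rule ccontr)
  assume "\<psi> \<noteq> 0"
  then obtain p where p: "\<psi> p \<noteq> 0" by (auto simp: fun_eq_iff)
  then have "p \<in> B" using \<psi> Cinf_outside by (auto simp: V_def)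
  have "(\<psi>, 0) \<in> Vstar B" using \<psi> by (simp add: Vstar_def V_def Cinf_0)
  then have "(LINT x:B|lborel. \<psi> x * \<psi> x) = 0" using zero by (force simp: pairing_Pair)
  moreover have "(LINT x:B|lborel. \<psi> x * \<psi> x) > 0"
    using \<psi> p \<open>p \<in> B\<close> by (intro domain_integral_pos[of _ p] continuous_intros)
      (auto simp: V_def Cinf_continuous_on not_sum_squares_lt_zero zero_less_mult_iff)
  ultimately show False by simp
qed

lemma continuous_on_bump: "continuous_on S (bump c r)" for c :: "'b::euclidean_space"
  using smooth_on_continuous_on[OF smooth_on_bump] continuous_on_subset by blast

text \<open>Test functions supported in the interior see only \<open>\<alpha>\<close>; once \<open>\<alpha> = 0\<close>, a cut-off of a local
  extension of \<open>\<alpha>d\<close> detects the boundary component.\<close>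

lemma pairing_nondegenerate_left:
  assumes \<beta>: "\<beta> \<in> Vstar B" and zero: "\<And>\<phi>. \<phi> \<in> V B \<Longrightarrow> pairing B \<beta> \<phi> = 0"
  shows "\<beta> = 0"
proof -
  obtain \<alpha> \<alpha>d where eq: "\<beta> = (\<alpha>, \<alpha>d)" by (metis surj_pair)
  have \<alpha>: "\<alpha> \<in> Cinf B" and \<alpha>d: "\<alpha>d \<in> Cinf (frontier B)" using \<beta> by (auto simp: eq Vstar_def)
  have int0: "\<alpha> c = 0" if c: "c \<in> interior B" for c
  proof (rule ccontr)
    assume nz: "\<alpha> c \<noteq> 0"
    obtain r where r: "r > 0" "cball c r \<subseteq> interior B"
      using c open_contains_cball open_interior by blast
    define \<phi> where "\<phi> x = (if x \<in> B then \<alpha> x * bump c r x else 0)" for x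
    have "\<phi> \<in> V B" unfolding V_def \<phi>_def[abs_def]
      by (rule Cinf_bump_mult[OF Cinf_smooth_on_interior[OF \<alpha>] r(2,1)])
    moreover have "\<phi> x = 0" if "x \<in> frontier B" for x
    proof -
      have "x \<notin> ball c r" using that r(2) by (auto simp: frontier_def subset_iff less_imp_le)
      then show ?thesis using bump_eq_0[of r x c] r(1) by (simp add: \<phi>_def)
    qed
    then have "(LINT x:frontier B|surface_measure. \<alpha>d x * \<phi> x) = 0"
      by (subst set_lebesgue_integral_cong[where g = "\<lambda>_. 0"]) (auto simp: set_lebesgue_integral_def)
    ultimately have "(LINT x:B|lborel. \<alpha> x * \<phi> x) = 0" using zero[of \<phi>] by (simp add: eq pairing_Pair)
    also have "(LINT x:B|lborel. \<alpha> x * \<phi> x) = (LINT x:B|lborel. \<alpha> x * \<alpha> x * bump c r x)"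
      using compact_B by (intro set_lebesgue_integral_cong) (auto simp: \<phi>_def borel_compact)
    also have "\<dots> > 0"
      using c nz interior_subset r(1) bump_pos[of c c r]
      by (intro domain_integral_pos[of _ c] continuous_intros continuous_on_bump Cinf_continuous_on \<alpha>)
        (auto simp: bump_nonneg zero_less_mult_iff)
    finally show False by simp
  qed
  have "\<alpha> x = 0" for x
  proof (cases "x \<in> B")
    case True
    \<comment> \<open>The interior is dense in \<open>B\<close>, so continuity extends the vanishing
      of \<open>\<alpha>\<close> to boundary points.\<close>
    have "closure (interior B) \<subseteq> B"
      using compact_imp_closed[OF compact_B] by (simp add: closure_minimal interior_subset)
    then have "continuous_on (closure (interior B)) \<alpha>"
      using Cinf_continuous_on[OF \<alpha>] continuous_on_subset by blast
    then show ?thesis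
      using continuous_constant_on_closure[of "interior B" \<alpha> 0 x] int0 True
        smooth_bounded_domain_subset_closure_interior[OF B] by blast
  qed (use Cinf_outside[OF \<alpha>] in blast)
  then have \<alpha>0: "\<alpha> = 0" by (simp add: fun_eq_iff)
  have "\<alpha>d p = 0" if p: "p \<in> frontier B" for p
  proof (rule ccontr)
    assume nz: "\<alpha>d p \<noteq> 0"
    obtain U g where g: "p \<in> U" "smooth_on U g" "\<And>x. x \<in> U \<Longrightarrow> x \<in> frontier B \<Longrightarrow> \<alpha>d x = g x"
      using CinfE[OF \<alpha>d p] by blast
    obtain r where r: "r > 0" "cball p r \<subseteq> U"
      using g(1) smooth_on_open[OF g(2)] open_contains_cball by blast
    define \<phi> where "\<phi> x = (if x \<in> B then g x * bump p r x else 0)" for x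
    have "\<phi> \<in> V B" unfolding V_def \<phi>_def[abs_def] by (rule Cinf_bump_mult[OF g(2) r(2,1)])
    then have "(LINT x:frontier B|surface_measure. \<alpha>d x * \<phi> x) = 0"
      using zero by (force simp: eq pairing_Pair \<alpha>0)
    also have "(LINT x:frontier B|surface_measure. \<alpha>d x * \<phi> x)
        = (LINT x:frontier B|surface_measure. \<alpha>d x * \<alpha>d x * bump p r x)"
    proof (intro set_lebesgue_integral_cong allI impI)
      fix x assume x: "x \<in> frontier B"
      then have "x \<in> B" using frontier_subset_smooth_bounded_domain[OF B] by blast
      show "\<alpha>d x * \<phi> x = \<alpha>d x * \<alpha>d x * bump p r x"
      \<comment> \<open>Inside the ball the extension \<open>g\<close> may be replaced by
        \<open>\<alpha>d\<close>; elsewhere the two may differ, but the bump vanishes.\<close>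
      proof (cases "x \<in> ball p r")
        case True
        then have "x \<in> U" using r(2) ball_subset_cball by blast
        then show ?thesis using \<open>x \<in> B\<close> g(3) x by (simp add: \<phi>_def)
      next
        case False
        then show ?thesis using bump_eq_0[of r x p] r(1) by (simp add: \<phi>_def)
      qed
    qed simp
    also have "\<dots> > 0"
      using p nz r(1) bump_pos[of p p r]
      by (intro frontier_integral_pos[of _ p] continuous_intros continuous_on_bump Cinf_continuous_on \<alpha>d)
        (auto simp: bump_nonneg zero_less_mult_iff)
    finally show False by simp
  qed
  then have "\<alpha>d = 0" using Cinf_outside[OF \<alpha>d] by (auto simp: fun_eq_iff)
  then show ?thesis by (simp add: eq \<alpha>0 zero_prod_def)
qed

section \<open>The canonical flat map\<close>

text \<open>The one-form is linear in the momentum component and ignores the base component, so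
  along \<open>z + t *\<^sub>R u\<close> it is affine in \<open>t\<close> and \<open>deriv\<close>
  reads off the slope.\<close>

lemma canonical_two_form_eq:
  assumes "z \<in> TstarV B" "u \<in> tangent_fiber B" "w \<in> tangent_fiber B"
  shows "canonical_two_form B z u w = pairing B (snd w) (fst u) - pairing B (snd u) (fst w)"
proof -
  have d: "deriv (\<lambda>t. canonical_one_form B (z + t *\<^sub>R u) w) 0 = pairing B (snd u) (fst w)"
    if u: "u \<in> tangent_fiber B" and w: "w \<in> tangent_fiber B" for u w
  proof (rule DERIV_imp_deriv)
    have "t *\<^sub>R \<beta> \<in> Vstar B" if "\<beta> \<in> Vstar B" for t \<beta>
      using that by (auto simp: Vstar_def Cinf_scaleR)
    then have "canonical_one_form B (z + t *\<^sub>R u) w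
        = pairing B (snd z) (fst w) + t * pairing B (snd u) (fst w)" for t
      using assms(1) u w
      by (simp add: canonical_one_form_def split_def pairing_add_left pairing_scaleR_left
          TstarV_def tangent_fiber_def mem_Times_iff)
    then show "((\<lambda>t. canonical_one_form B (z + t *\<^sub>R u) w) has_field_derivative pairing B (snd u) (fst w)) (at 0)"
      by (auto intro!: derivative_eq_intros)
  qed
  show ?thesis
    unfolding canonical_two_form_def ext_derivative_def d[OF assms(2,3)] d[OF assms(3,2)] by simp
qed

lemma covec_act_eq: "covec_act B a w = pairing B (fst a) (fst w) + pairing B (snd w) (snd a)"
  by (simp add: covec_act_def split_def)

text \<open>Tangent vectors \<open>(\<phi>, 0)\<close> and \<open>(0, \<beta>)\<close> isolate the
  two components of a covector, and nondegeneracy on either side determines them. This is the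
  uniqueness behind the \<open>THE\<close> in \<open>Omega_flat\<close>.\<close>

lemma covec_eqI:
  assumes "a \<in> cotangent_fiber B" "a' \<in> cotangent_fiber B"
    and eq: "\<And>w. w \<in> tangent_fiber B \<Longrightarrow> covec_act B a w = covec_act B a' w"
  shows "a = a'"
proof -
  have a: "fst a \<in> Vstar B" "fst a' \<in> Vstar B" "snd a \<in> V B" "snd a' \<in> V B"
    using assms by (auto simp: cotangent_fiber_def)
  have "fst a - fst a' = 0"
  proof (rule pairing_nondegenerate_left)
    fix \<phi> assume \<phi>: "\<phi> \<in> V B"
    then have "pairing B (fst a) \<phi> = pairing B (fst a') \<phi>"
      using eq[of "(\<phi>, 0)"] by (simp add: tangent_fiber_def Vstar_0 covec_act_eq pairing_0_left)
    then show "pairing B (fst a - fst a') \<phi> = 0" by (simp add: pairing_diff_left a \<phi>)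
  qed (simp add: Vstar_diff a)
  moreover have "snd a - snd a' = 0"
  proof (rule pairing_nondegenerate_right)
    fix \<beta> assume \<beta>: "\<beta> \<in> Vstar B"
    then have "pairing B \<beta> (snd a) = pairing B \<beta> (snd a')"
      using eq[of "(0, \<beta>)"] by (simp add: tangent_fiber_def V_0 covec_act_eq pairing_0_right)
    then show "pairing B \<beta> (snd a - snd a') = 0" by (simp add: pairing_diff_right a \<beta>)
  qed (simp add: V_diff a)
  ultimately show ?thesis by (simp add: prod_eq_iff)
qed

lemma Omega_flat_eq:
  assumes "z \<in> TstarV B" "u \<in> tangent_fiber B"
  shows "Omega_flat B z u = (- snd u, fst u)"
  unfolding Omega_flat_def
proof (rule the_equality)
  show *: "(- snd u, fst u) \<in> cotangent_fiber B \<and>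
      (\<forall>w\<in>tangent_fiber B. covec_act B (- snd u, fst u) w = canonical_two_form B z u w)"
    using assms by (simp add: cotangent_fiber_def tangent_fiber_def[of B] mem_Times_iff Vstar_uminus
        canonical_two_form_eq covec_act_eq pairing_uminus_left)
  fix a assume "a \<in> cotangent_fiber B \<and> (\<forall>w\<in>tangent_fiber B. covec_act B a w = canonical_two_form B z u w)"
  then show "a = (- snd u, fst u)" using * by (intro covec_eqI) auto
qed

lemma graph_Omega_flat_eq:
  "graph_Omega_flat B = {(z, u, (- snd u, fst u)) | z u. z \<in> TstarV B \<and> u \<in> tangent_fiber B}"
  unfolding graph_Omega_flat_def by (auto simp: Omega_flat_eq)

lemma orthogonal_bundle_graph_Omega_flat: "orthogonal_bundle B (graph_Omega_flat B) = graph_Omega_flat B"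
proof (intro set_eqI iffI)
  fix v assume "v \<in> orthogonal_bundle B (graph_Omega_flat B)"
  then obtain z u a where v: "v = (z, u, a)" and z: "z \<in> TstarV B" and u: "u \<in> tangent_fiber B"
    and a: "a \<in> cotangent_fiber B"
    and orth: "\<And>w. w \<in> tangent_fiber B \<Longrightarrow> Pontryagin_pairing B (u, a) (w, (- snd w, fst w)) = 0"
    by (auto simp: orthogonal_bundle_def Pontryagin_bundle_def graph_Omega_flat_eq)
  have "a = (- snd u, fst u)"
  proof (rule covec_eqI[OF a])
    show "(- snd u, fst u) \<in> cotangent_fiber B"
      using u by (simp add: cotangent_fiber_def tangent_fiber_def mem_Times_iff Vstar_uminus)
    fix w assume "w \<in> tangent_fiber B"
    \<comment> \<open>Expanded, the pairing with the graph element over \<open>w\<close> is the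
      difference of the two actions on \<open>w\<close>.\<close>
    from orth[OF this] show "covec_act B a w = covec_act B (- snd u, fst u) w"
      by (simp add: Pontryagin_pairing_def covec_act_eq pairing_uminus_left)
  qed
  then show "v \<in> graph_Omega_flat B" using v z u unfolding graph_Omega_flat_eq by blast
next
  fix v assume "v \<in> graph_Omega_flat B"
  then obtain z u where v: "v = (z, u, (- snd u, fst u))" and z: "z \<in> TstarV B" and u: "u \<in> tangent_fiber B"
    unfolding graph_Omega_flat_eq by blast
  have "Pontryagin_pairing B (u, (- snd u, fst u)) v2 = 0" if v2: "(z, v2) \<in> graph_Omega_flat B" for v2
  proof -
    obtain w where "v2 = (w, (- snd w, fst w))" using v2 unfolding graph_Omega_flat_eq by blast
    then show ?thesis by (simp add: Pontryagin_pairing_def covec_act_eq pairing_uminus_left)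
  qed
  moreover have "(- snd u, fst u) \<in> cotangent_fiber B"
    using u by (simp add: cotangent_fiber_def tangent_fiber_def mem_Times_iff Vstar_uminus)
  ultimately show "v \<in> orthogonal_bundle B (graph_Omega_flat B)"
    using z u by (simp add: v orthogonal_bundle_def Pontryagin_bundle_def)
qed

end

section \<open>Constant subbundles\<close>

text \<open>The carrier of a generated topology is the union of its generators; one \<open>p\<close>
  with \<open>p 0 = 0\<close> puts every \<open>f\<close> into a ball around itself.\<close>

lemma topspace_seminorm_topology:
  assumes "p \<in> P" "p 0 = 0"
  shows "topspace (seminorm_topology X P) = X"
  unfolding seminorm_topology_def topology_generated_by_topspace
proof (intro equalityI subsetI)
  fix f assume "f \<in> X"
  then have "f \<in> {g \<in> X. p (g - f) < 1}" using assms(2) by simp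
  then show "f \<in> \<Union> {{g \<in> X. p (g - f) < e} |p f e. p \<in> P \<and> f \<in> X \<and> 0 < e}"
    using assms(1) \<open>f \<in> X\<close> zero_less_one by blast
qed blast

text \<open>The preimage of the \<open>p\<close>-ball around \<open>f\<close> is the one around
  \<open>- f\<close>, because \<open>p\<close> is even; so subbasic sets pull back to subbasic
  sets.\<close>

lemma continuous_map_uminus_seminorm_topology:
  fixes X :: "'v::real_vector set"
  assumes top: "topspace (seminorm_topology X P) = X"
    and neg: "\<And>f. f \<in> X \<Longrightarrow> - f \<in> X" and diff: "\<And>f g. f \<in> X \<Longrightarrow> g \<in> X \<Longrightarrow> f - g \<in> X"
    and sym: "\<And>p f. p \<in> P \<Longrightarrow> f \<in> X \<Longrightarrow> p (- f) = p f"
  shows "continuous_map (seminorm_topology X P) (seminorm_topology X P) uminus"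
proof (subst (2) seminorm_topology_def, rule continuous_on_generated_topo)
  fix U assume "U \<in> {{g \<in> X. p (g - f) < e} |p f e. p \<in> P \<and> f \<in> X \<and> e > 0}"
  then obtain p f e where U: "U = {g \<in> X. p (g - f) < e}" and p: "p \<in> P" and f: "f \<in> X" and e: "e > 0"
    by blast
  have "p (- g - f) = p (g - (- f))" if "g \<in> X" for g
  proof -
    have "- g - f = - (g - (- f))" by simp
    then show ?thesis using sym[OF p diff[OF that neg[OF f]]] by (simp only:)
  qed
  then have "uminus -` U \<inter> topspace (seminorm_topology X P) = {g \<in> X. p (g - (- f)) < e}"
    unfolding top U using neg by auto
  moreover have "openin (seminorm_topology X P) {g \<in> X. p (g - (- f)) < e}"
    unfolding seminorm_topology_def by (rule topology_generated_by_Basis) (use p neg[OF f] e in blast)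
  ultimately show "openin (seminorm_topology X P) (uminus -` U \<inter> topspace (seminorm_topology X P))" by simp
next
  have "uminus ` X \<subseteq> X" using neg by blast
  then show "uminus ` topspace (seminorm_topology X P) \<subseteq> \<Union> {{g \<in> X. p (g - f) < e} |p f e. p \<in> P \<and> f \<in> X \<and> e > 0}"
    using top by (simp add: seminorm_topology_def)
qed

text \<open>This is the local form of the identity bundle map. Being linear, it has first derivative
  \<open>snd (h 0)\<close> and zero higher derivatives, and the difference quotients equal their
  limit for every nonzero \<open>t\<close>.\<close>

lemma frechet_smooth_snd:
  fixes X :: "'a::real_vector topology" and Y :: "'b::real_vector topology"
  assumes "0 \<in> topspace Y"
  shows "frechet_smooth (prod_topology X Y) U Y (\<lambda>(x, y). y)"
proof -
  define D where "D k h x = (if k = 0 then snd x else if k = Suc 0 then snd (h 0) else 0)"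
    for k :: nat and h :: "nat \<Rightarrow> 'a \<times> 'b" and x :: "'a \<times> 'b"
  let ?X = "prod_topology X Y"
  have "D 0 h x = (case x of (x, y) \<Rightarrow> y)" for h x by (simp add: D_def split_def)
  moreover have "limitin Y (\<lambda>t::real. (1 / t) *\<^sub>R (D k h (x + t *\<^sub>R h k) - D k h x)) (D (Suc k) h x) (at 0)"
    if "range h \<subseteq> topspace ?X" for k h x
    unfolding limitin_def
  proof (intro conjI allI impI)
    have "h 0 \<in> topspace ?X" using that by blast
    then show "D (Suc k) h x \<in> topspace Y" using assms by (auto simp: D_def)
    fix W assume W: "openin Y W \<and> D (Suc k) h x \<in> W"
    have "(1 / t) *\<^sub>R (D k h (x + t *\<^sub>R h k) - D k h x) = D (Suc k) h x" if "t \<noteq> 0" for t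
      using that by (auto simp: D_def)
    then show "\<forall>\<^sub>F t in at (0::real). (1 / t) *\<^sub>R (D k h (x + t *\<^sub>R h k) - D k h x) \<in> W"
      using W by (auto simp: eventually_at intro!: exI[of _ 1])
  qed
  moreover have "continuous_map (prod_topology (product_topology (\<lambda>_. ?X) UNIV) (subtopology ?X U)) Y (\<lambda>(h, x). D k h x)" for k
  proof -
    consider "k = 0" | "k = Suc 0" | "k \<ge> 2" by linarith
    then show ?thesis
    proof cases
      case 1
      then have "(\<lambda>(h, x). D k h x) = snd \<circ> snd" by (auto simp: D_def)
      then show ?thesis
        using continuous_map_compose[OF continuous_map_snd continuous_map_from_subtopology[OF continuous_map_snd]]
        by metis
    next
      case 2
      then have "(\<lambda>(h, x). D k h x) = snd \<circ> ((\<lambda>h. h 0) \<circ> fst)" by (auto simp: D_def)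
      moreover have "continuous_map (prod_topology (product_topology (\<lambda>_. ?X) UNIV) (subtopology ?X U)) ?X ((\<lambda>h. h 0) \<circ> fst)"
        by (rule continuous_map_compose[OF continuous_map_fst continuous_map_product_coordinates]) simp
      ultimately show ?thesis using continuous_map_snd_of by metis
    next
      case 3
      then have "(\<lambda>(h, x). D k h x) = (\<lambda>_. 0)" by (auto simp: D_def)
      then show ?thesis using assms by simp
    qed
  qed
  ultimately show ?thesis unfolding frechet_smooth_def by (intro exI[of _ D]) blast
qed

text \<open>For fibers equal to one fixed range, the whole base serves as \<open>U\<close> and the
  identity as both \<open>\<Phi>\<close> and \<open>\<Psi>\<close>.\<close>

lemma vector_subbundle_constant:
  assumes "0 \<in> topspace E" "linear P" "continuous_map E E P" "\<And>e. e \<in> topspace E \<Longrightarrow> P (P e) = P e"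
  shows "vector_subbundle M E (topspace M \<times> P ` topspace E)"
  unfolding vector_subbundle_def
proof (intro conjI ballI)
  have "P ` topspace E \<subseteq> topspace E" using assms(3) by (rule continuous_map_image_subset_topspace)
  then show "topspace M \<times> P ` topspace E \<subseteq> topspace M \<times> topspace E" by blast
  fix z0 assume "z0 \<in> topspace M"
  then show "\<exists>U \<Phi> \<Psi> P'. openin M U \<and> z0 \<in> U \<and>
        (\<forall>z\<in>U. linear (\<Phi> z) \<and> linear (\<Psi> z) \<and>
           (\<forall>e\<in>topspace E. \<Phi> z e \<in> topspace E \<and> \<Psi> z e \<in> topspace E \<and>
              \<Psi> z (\<Phi> z e) = e \<and> \<Phi> z (\<Psi> z e) = e)) \<and>
        frechet_smooth (prod_topology M E) (U \<times> topspace E) E (\<lambda>(z, e). \<Phi> z e) \<and>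
        frechet_smooth (prod_topology M E) (U \<times> topspace E) E (\<lambda>(z, e). \<Psi> z e) \<and>
        linear P' \<and> continuous_map E E P' \<and> (\<forall>e\<in>topspace E. P' (P' e) = P' e) \<and>
        (\<forall>z\<in>U. \<forall>e\<in>topspace E. (z, e) \<in> topspace M \<times> P ` topspace E \<longleftrightarrow> \<Phi> z e \<in> P' ` topspace E)"
    using assms frechet_smooth_snd[OF assms(1)]
    by (intro exI[of _ "topspace M"] exI[of _ "\<lambda>_ e. e"] exI[of _ P]) (auto simp: linear_id[unfolded id_def])
qed

section \<open>The graph of the flat map as a subbundle\<close>

lemma topspace_Cinf_topology:
  assumes "smooth_bounded_domain B"
  shows "topspace (Cinf_topology B) = Cinf B"
  unfolding Cinf_topology_def
proof (rule topspace_seminorm_topology)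
  let ?p = "\<lambda>f. SUP x\<in>interior B. \<bar>iter_partial [] f x\<bar> :: real"
  show "?p \<in> {(\<lambda>f. SUP x\<in>interior B. \<bar>iter_partial bs f x\<bar>) | bs. bs \<in> lists Basis}" by blast
  \<comment> \<open>A supremum over the empty set would be unspecified; the nonempty interior of the
    domain makes it 0.\<close>
  show "?p 0 = 0" using assms by (simp add: smooth_bounded_domain_def)
qed

lemma topspace_Cinf_boundary_topology:
  fixes B :: "'a::euclidean_space set"
  assumes "smooth_bounded_domain B"
  shows "topspace (Cinf_boundary_topology B) = Cinf (frontier B)"
proof -
  obtain c where c: "c \<in> frontier B" using frontier_smooth_bounded_domain_nonempty[OF assms] by blast
  show ?thesis unfolding Cinf_boundary_topology_def
  proof (rule topspace_seminorm_topology)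
    \<comment> \<open>A constant map into the nonempty boundary and a one-point compact set give an
      admissible seminorm that vanishes at 0.\<close>
    let ?p = "\<lambda>f. SUP x\<in>{0}. \<bar>iter_partial [] (f \<circ> (\<lambda>_::'a. c)) x\<bar> :: real"
    have "smooth_on UNIV (\<lambda>_::'a. c)" by (rule smooth_on_const) simp
    then show "?p \<in> {(\<lambda>f. SUP x\<in>K. \<bar>iter_partial bs (f \<circ> \<gamma>) x\<bar>) | bs (\<gamma> :: 'a \<Rightarrow> 'a) W K.
        bs \<in> lists Basis \<and> smooth_on W \<gamma> \<and> \<gamma> ` W \<subseteq> frontier B \<and> compact K \<and> K \<noteq> {} \<and> K \<subseteq> W}"
      using c by (intro CollectI exI[of _ "[]"] exI[of _ "\<lambda>_::'a. c"] exI[of _ UNIV] exI[of _ "{0}"]) auto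
    show "?p 0 = 0" by simp
  qed
qed

lemma continuous_map_uminus_Cinf_topology:
  fixes B :: "'a::euclidean_space set"
  assumes "smooth_bounded_domain B"
  shows "continuous_map (Cinf_topology B) (Cinf_topology B) uminus"
  unfolding Cinf_topology_def
proof (rule continuous_map_uminus_seminorm_topology)
  fix p :: "('a \<Rightarrow> real) \<Rightarrow> real" and f
  assume p: "p \<in> {(\<lambda>f. SUP x\<in>interior B. \<bar>iter_partial bs f x\<bar>) | bs. bs \<in> lists Basis}"
    and f: "f \<in> Cinf B"
  obtain bs where bs: "bs \<in> lists Basis" "p = (\<lambda>f. SUP x\<in>interior B. \<bar>iter_partial bs f x\<bar>)"
    using p by blast
  have "\<bar>iter_partial bs (- f) x\<bar> = \<bar>iter_partial bs f x\<bar>" if "x \<in> interior B" for x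
    using iter_partial_uminus[OF Cinf_smooth_on_interior[OF f] bs(1) that] by (simp add: fun_Compl_def)
  then show "p (- f) = p f" by (simp add: bs(2))
qed (use topspace_Cinf_topology[OF assms] in \<open>auto simp: Cinf_topology_def Cinf_uminus Cinf_diff\<close>)

lemma continuous_map_uminus_Cinf_boundary_topology:
  fixes B :: "'a::euclidean_space set"
  assumes "smooth_bounded_domain B"
  shows "continuous_map (Cinf_boundary_topology B) (Cinf_boundary_topology B) uminus"
  unfolding Cinf_boundary_topology_def
proof (rule continuous_map_uminus_seminorm_topology)
  fix p :: "('a \<Rightarrow> real) \<Rightarrow> real" and f
  assume p: "p \<in> {(\<lambda>f. SUP x\<in>K. \<bar>iter_partial bs (f \<circ> \<gamma>) x\<bar>) | bs (\<gamma> :: 'a \<Rightarrow> 'a) W K.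
        bs \<in> lists Basis \<and> smooth_on W \<gamma> \<and> \<gamma> ` W \<subseteq> frontier B \<and> compact K \<and> K \<noteq> {} \<and> K \<subseteq> W}"
    and f: "f \<in> Cinf (frontier B)"
  obtain bs W K and \<gamma> :: "'a \<Rightarrow> 'a" where bs: "bs \<in> lists Basis" "smooth_on W \<gamma>" "\<gamma> ` W \<subseteq> frontier B" "K \<subseteq> W"
    and p_eq: "p = (\<lambda>f. SUP x\<in>K. \<bar>iter_partial bs (f \<circ> \<gamma>) x\<bar>)"
    using p by blast
  have "\<bar>iter_partial bs ((- f) \<circ> \<gamma>) x\<bar> = \<bar>iter_partial bs (f \<circ> \<gamma>) x\<bar>" if "x \<in> K" for x
    using iter_partial_uminus[OF Cinf_compose_smooth[OF f bs(2,3)] bs(1), of x] that bs(4)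
    by (auto simp: comp_def)
  then show "p (- f) = p f" by (simp add: p_eq)
qed (use topspace_Cinf_boundary_topology[OF assms] in \<open>auto simp: Cinf_boundary_topology_def Cinf_uminus Cinf_diff\<close>)

lemma vector_subbundle_graph_Omega_flat:
  fixes B :: "(real ^ 'm) set"
  assumes B: "smooth_bounded_domain B"
  shows "vector_subbundle (phase_topology B) (prod_topology (phase_topology B) (covec_topology B)) (graph_Omega_flat B)"
proof -
  let ?M = "phase_topology B" and ?E = "prod_topology (phase_topology B) (covec_topology B)"
  define P :: "(real ^ 'm) phase \<times> (real ^ 'm) covec \<Rightarrow> (real ^ 'm) phase \<times> (real ^ 'm) covec"
    where "P = (\<lambda>(u, a). (u, (- snd u, fst u)))"
  note top = topspace_Cinf_topology[OF B] topspace_Cinf_boundary_topology[OF B]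
  have M: "topspace ?M = TstarV B"
    by (simp add: phase_topology_def Vstar_topology_def top TstarV_def V_def Vstar_def)
  have E: "topspace ?E = tangent_fiber B \<times> cotangent_fiber B"
    by (simp add: phase_topology_def covec_topology_def Vstar_topology_def top tangent_fiber_def
        cotangent_fiber_def V_def Vstar_def)
  have zero: "0 \<in> tangent_fiber B" "0 \<in> cotangent_fiber B"
    by (simp_all add: tangent_fiber_def cotangent_fiber_def zero_prod_def V_def Vstar_def Cinf_0)
  have "graph_Omega_flat B = topspace ?M \<times> P ` topspace ?E"
  proof (intro equalityI subsetI)
    fix v assume "v \<in> graph_Omega_flat B"
    then obtain z u where v: "v = (z, u, (- snd u, fst u))" "z \<in> TstarV B" "u \<in> tangent_fiber B"
      unfolding graph_Omega_flat_eq[OF B] by blast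
    moreover have "(u, (- snd u, fst u)) = P (u, 0)" by (simp add: P_def)
    ultimately show "v \<in> topspace ?M \<times> P ` topspace ?E"
      using zero(2) unfolding M E by blast
  next
    fix v assume "v \<in> topspace ?M \<times> P ` topspace ?E"
    then obtain z u a where "v = (z, P (u, a))" "z \<in> TstarV B" "u \<in> tangent_fiber B"
      unfolding M E by blast
    moreover have "P (u, a) = (u, (- snd u, fst u))" by (simp add: P_def)
    ultimately show "v \<in> graph_Omega_flat B"
      unfolding graph_Omega_flat_eq[OF B] by blast
  qed
  moreover have "vector_subbundle ?M ?E (topspace ?M \<times> P ` topspace ?E)"
  proof (rule vector_subbundle_constant)
    show "0 \<in> topspace ?E" unfolding E using zero by (metis SigmaI zero_prod_def)
    show "linear P" by (rule linearI) (auto simp: P_def)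
    show "P (P e) = P e" for e by (simp add: P_def split_def)
    have neg: "continuous_map (Vstar_topology B) (Vstar_topology B) uminus"
    proof -
      have eq: "uminus = (\<lambda>\<beta> :: (real ^ 'm) dual. (- fst \<beta>, - snd \<beta>))" by (auto simp: uminus_prod_def)
      have "continuous_map (Vstar_topology B) (Cinf_topology B) (\<lambda>\<beta>. - fst \<beta>)"
        using continuous_map_compose[OF continuous_map_fst continuous_map_uminus_Cinf_topology[OF B]]
        by (simp add: Vstar_topology_def comp_def)
      moreover have "continuous_map (Vstar_topology B) (Cinf_boundary_topology B) (\<lambda>\<beta>. - snd \<beta>)"
        using continuous_map_compose[OF continuous_map_snd continuous_map_uminus_Cinf_boundary_topology[OF B]]
        by (simp add: Vstar_topology_def comp_def)
      ultimately show ?thesis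
        by (subst eq, subst (2) Vstar_topology_def) (rule continuous_map_pairedI)
    qed
    have "P = (\<lambda>e. (fst e, (- snd (fst e), fst (fst e))))" by (simp add: P_def split_def)
    moreover have "continuous_map ?E (phase_topology B) fst" by (rule continuous_map_fst)
    moreover have "continuous_map ?E (Cinf_topology B) (\<lambda>e. fst (fst e))"
    proof -
      have "continuous_map ?E (Cinf_topology B) (fst \<circ> fst)"
        unfolding phase_topology_def by (rule continuous_map_compose[OF continuous_map_fst continuous_map_fst])
      then show ?thesis by (simp add: comp_def)
    qed
    moreover have "continuous_map ?E (Vstar_topology B) (\<lambda>e. - snd (fst e))"
    proof -
      have "continuous_map ?E (Vstar_topology B) (snd \<circ> fst)"
        unfolding phase_topology_def by (rule continuous_map_compose[OF continuous_map_fst continuous_map_snd])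
      from continuous_map_compose[OF this neg] show ?thesis by (simp add: comp_def)
    qed
    ultimately show "continuous_map ?E ?E P"
      by (auto intro!: continuous_map_pairedI simp: covec_topology_def)
  qed
  ultimately show ?thesis by simp
qed

theorem proposition3p8:
  fixes B :: "(real ^ 'm) set"
  assumes "smooth_bounded_domain B"
  shows "Dirac_structure B (graph_Omega_flat B)"
  unfolding Dirac_structure_def
  using vector_subbundle_graph_Omega_flat[OF assms] orthogonal_bundle_graph_Omega_flat[OF assms] by blast

end
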